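(* For each integer $d\ge 3$ let $\mu=\mu_d$ be a spherically symmetric probability measure on $\mathbb{R}^d$, and assume the norm-concentration property: there is a constant $c>0$ not depending on $d$ such that, for all $\epsilon>0$ and all $d$, $$\mu_d\left\{\left|\,\|U\|-1\,\right|\ge\epsilon\right\}\le 2\exp(-c\,d\,\epsilon^2)\qquad (U\sim\mu_d).$$ Let $s>0$ be fixed and let $n=n(d)$ be integers with $n(d)\to\infty$ as $d\to\infty$. Let $\widehat{a^*}(d,n,s)$ denote a value of $a\ge0$ minimising the extreme-value approximation $\widehat E_{\mu_d,s}(n;a)$ of the $L_s$-mean quantisation error for random quantisers made of $n$ i.i.d. points uniform on the sphere of radius $a$ in $\mathbb{R}^d$ (defined in the context). Then, as $d\to\infty$: (i) if $n^{1/d}\to\infty$, then $\lim_{d\to\infty}\widehat{a^*}(d,n,s)=1$; (ii) if $n=\lambda^d(1+o(1))$ with $\lambda>1$, then $\lim_{d\to\infty}\widehat{a^*}(d,n,s)=\sqrt{1-1/\lambda^2}$; (iii) if $\log n=o(d)$, then $\lim_{d\to\infty}\widehat{a^*}(d,n,s)=0$.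
   Context: A probability measure on $\mathbb{R}^d$ is spherically symmetric if it is the distribution of $R\cdot Z$ with $R\ge 0$ a random variable and $Z$ uniform on the unit sphere, independent of $R$. For $d\ge 3$ and $\delta=(d-1)/2$, $\kappa_{n,d}$ denotes the $1/n$ quantile of the Beta$(\delta,\delta)$ distribution, i.e. $I_{\kappa_{n,d}}(\delta,\delta)=1/n$ with $I_t(p,q)$ the regularised incomplete Beta function, and $F_d(t)=1-\exp(-t^\delta)$, $t\ge0$, is a Weibull c.d.f. For $\mu$ on $\mathbb{R}^d$, let $\Psi$ be the c.d.f. of $\|U\|$ when $U$ has distribution $\mu$. For $s>0$ and $a\ge 0$ the extreme-value approximation of the $(\mu,s)$-distortion is defined by $$\widehat E_{\mu,s}^s(n;a)=\int_{r\ge0}\int_{\zeta\ge0}\left[(r-a)^2+4\,a\,r\,\kappa_{n,d}\,\zeta\right]^{s/2}\,\mathrm{d}F_d(\zeta)\,\mathrm{d}\Psi(r),$$ and $\widehat E_{\mu,s}(n;a)=\left[\widehat E_{\mu,s}^s(n;a)\right]^{1/s}$. *)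

theory Defs
  imports "HOL-Probability.Probability" "HOL-Library.Landau_Symbols"
begin

text \<open>
  The dimension \<open>d\<close> varies inside the statement, so vectors of \<open>\<real>\<^sup>d\<close> are the
  extensional functions on \<open>{..<d}\<close> and the Euclidean norm of \<open>x\<close> is
  \<open>L2_set x {..<d}\<close>.
\<close>

definition borel_R :: "nat \<Rightarrow> (nat \<Rightarrow> real) measure" where
  "borel_R d = Pi\<^sub>M {..<d} (\<lambda>_. borel)"

definition lborel_R :: "nat \<Rightarrow> (nat \<Rightarrow> real) measure" where
  "lborel_R d = Pi\<^sub>M {..<d} (\<lambda>_. lborel)"

definition scale_R :: "nat \<Rightarrow> real \<Rightarrow> (nat \<Rightarrow> real) \<Rightarrow> (nat \<Rightarrow> real)" where
  "scale_R d r x = (\<lambda>i\<in>{..<d}. r * x i)"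

text \<open>
  The uniform distribution on the unit sphere as normalised cone measure: the law
  of \<open>X / \<parallel>X\<parallel>\<close> for \<open>X\<close> uniform in the unit ball. The convention at \<open>X = 0\<close> only
  affects a null set (for \<open>d \<ge> 1\<close>).
\<close>

definition uniform_sphere :: "nat \<Rightarrow> (nat \<Rightarrow> real) measure" where
  "uniform_sphere d =
     distr (uniform_measure (lborel_R d) {x \<in> space (lborel_R d). L2_set x {..<d} \<le> 1})
       (borel_R d) (\<lambda>x. scale_R d (1 / L2_set x {..<d}) x)"

text \<open>
  Independence of \<open>R\<close> (with law \<open>\<rho>\<close>) and \<open>Z\<close> is expressed by taking the joint law to
  be a product measure.
\<close>

definition spherically_symmetric :: "nat \<Rightarrow> (nat \<Rightarrow> real) measure \<Rightarrow> bool" where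
  "spherically_symmetric d \<mu> \<longleftrightarrow>
     (\<exists>\<rho>. real_distribution \<rho> \<and> (AE r in \<rho>. 0 \<le> r) \<and>
          \<mu> = distr (\<rho> \<Otimes>\<^sub>M uniform_sphere d) (borel_R d) (\<lambda>(r, z). scale_R d r z))"

definition delta :: "nat \<Rightarrow> real" where
  "delta d = (real d - 1) / 2"

definition reg_inc_Beta :: "real \<Rightarrow> real \<Rightarrow> real \<Rightarrow> real" where
  "reg_inc_Beta t p q =
     integral {0..t} (\<lambda>u. u powr (p - 1) * (1 - u) powr (q - 1)) / Beta p q"

definition kappa :: "nat \<Rightarrow> nat \<Rightarrow> real" where
  "kappa n d = (THE t. t \<in> {0..1} \<and> reg_inc_Beta t (delta d) (delta d) = 1 / real n)"

definition weibull_cdf :: "nat \<Rightarrow> real \<Rightarrow> real" where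
  "weibull_cdf d t = (if 0 \<le> t then 1 - exp (- (t powr delta d)) else 0)"

definition norm_cdf :: "nat \<Rightarrow> (nat \<Rightarrow> real) measure \<Rightarrow> real \<Rightarrow> real" where
  "norm_cdf d \<mu> = cdf (distr \<mu> borel (\<lambda>x. L2_set x {..<d}))"

text \<open>
  \<open>Ehat_pow\<close> is the \<open>s\<close>-th power of the approximation. The Stieltjes integrals are
  Bochner integrals against \<open>interval_measure\<close>; the outer one includes a possible
  atom at \<open>0\<close>. They give the intended (finite) value whenever \<open>\<parallel>U\<parallel>\<close> has a finite
  \<open>s\<close>-th moment, as norm concentration ensures; otherwise they default to \<open>0\<close>
  instead of \<open>\<infinity>\<close>.
\<close>

definition Ehat_pow :: "nat \<Rightarrow> (nat \<Rightarrow> real) measure \<Rightarrow> real \<Rightarrow> nat \<Rightarrow> real \<Rightarrow> real" where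
  "Ehat_pow d \<mu> s n a =
     (LINT r:{0..}|interval_measure (norm_cdf d \<mu>).
       (LINT \<zeta>:{0..}|interval_measure (weibull_cdf d).
         ((r - a)\<^sup>2 + 4 * a * r * kappa n d * \<zeta>) powr (s / 2)))"

definition Ehat :: "nat \<Rightarrow> (nat \<Rightarrow> real) measure \<Rightarrow> real \<Rightarrow> nat \<Rightarrow> real \<Rightarrow> real" where
  "Ehat d \<mu> s n a = Ehat_pow d \<mu> s n a powr (1 / s)"

end

theory Submission
  imports Defs "HOL-Real_Asymp.Real_Asymp"
begin

text \<open>
  Both the norm \<open>r\<close> and the Weibull variable \<open>\<zeta>\<close> concentrate at \<open>1\<close>, while
  \<open>n powr (- 1 / d) \<longlonglongrightarrow> l\<close> forces the Beta quantile to satisfy \<open>4 * \<kappa> * (1 - \<kappa>) \<longlonglongrightarrow> l\<^sup>2\<close>, since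
  the Beta integrand is \<open>(u * (1 - u)) powr (\<delta> - 1)\<close> with \<open>\<delta> \<sim> d / 2\<close>. The integrand of
  \<open>Ehat_pow\<close> is thus close to \<open>((1 - a)\<^sup>2 + 4 * a * \<kappa>) powr (s / 2)\<close>, whose base is
  \<open>(a - a\<^sub>0)\<^sup>2 + 1 - a\<^sub>0\<^sup>2\<close> with \<open>a\<^sub>0 = 1 - 2 * \<kappa> = sqrt (1 - l\<^sup>2)\<close>. At \<open>a = a\<^sub>0\<close> the concentration,
  in the form of vanishing tail moments, bounds the integral from above; for
  \<open>\<bar>a - a\<^sub>0\<bar> \<ge> \<epsilon>\<close> the good event alone gives a strictly larger lower bound, uniformly in
  \<open>a\<close>, so that no minimiser can lie there. The three regimes are \<open>l = 0\<close>, \<open>l = 1 / \<lambda>\<close> and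
  \<open>l = 1\<close>.
\<close>

subsection \<open>Beta quantiles\<close>

text \<open>Both Beta parameters equal \<open>delta d\<close> in the application, so one exponent
  suffices and the kernel is symmetric about 1/2.\<close>

definition beta_kernel :: "real \<Rightarrow> real \<Rightarrow> real" where
  "beta_kernel p u = u powr (p - 1) * (1 - u) powr (p - 1)"

context
  fixes p :: real
  assumes p: "p > 1"
begin

lemma beta_kernel_eq: "u \<in> {0..1} \<Longrightarrow> beta_kernel p u = (u * (1 - u)) powr (p - 1)"
  by (simp add: beta_kernel_def powr_mult)

lemma beta_kernel_cont: "continuous_on {0..1} (beta_kernel p)"
  unfolding beta_kernel_def using p
  by (intro continuous_on_mult continuous_on_powr' continuous_on_diff continuous_on_id continuous_on_const) auto

lemma beta_kernel_int: "0 \<le> a \<Longrightarrow> b \<le> 1 \<Longrightarrow> beta_kernel p integrable_on {a..b}"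
  by (rule integrable_continuous_real, rule continuous_on_subset[OF beta_kernel_cont]) auto

lemma beta_kernel_nonneg: "beta_kernel p u \<ge> 0"
  by (simp add: beta_kernel_def)

lemma beta_kernel_symmetric: "beta_kernel p (1 - u) = beta_kernel p u"
  by (simp add: beta_kernel_def mult.commute)

lemma beta_kernel_mono:
  assumes "0 \<le> u" "u \<le> v" "v \<le> 1/2"
  shows "beta_kernel p u \<le> beta_kernel p v"
proof -
  have "0 \<le> (v - u) * (1 - u - v)" using assms by (intro mult_nonneg_nonneg) auto
  then have "u * (1 - u) \<le> v * (1 - v)" by (simp add: algebra_simps)
  then show ?thesis
    using assms p by (auto simp: beta_kernel_eq intro!: powr_mono2)
qed

text \<open>The kernel increases on the left half, so length times endpoint value bounds the
  integral. Such crude bounds suffice because only \<open>(p - 1)\<close>-th roots with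
  \<open>p\<close> tending to infinity matter later, and these flatten constant factors.\<close>

lemma integral_beta_kernel_bounds:
  assumes "0 \<le> a" "a \<le> b" "b \<le> 1/2"
  shows "(b - a) * beta_kernel p a \<le> integral {a..b} (beta_kernel p)"
    and "integral {a..b} (beta_kernel p) \<le> (b - a) * beta_kernel p b"
proof -
  have "integral {a..b} (\<lambda>_. beta_kernel p a) \<le> integral {a..b} (beta_kernel p)"
    using assms by (intro integral_le beta_kernel_int) (auto intro!: beta_kernel_mono)
  then show "(b - a) * beta_kernel p a \<le> integral {a..b} (beta_kernel p)"
    using assms by simp
  have "integral {a..b} (beta_kernel p) \<le> integral {a..b} (\<lambda>_. beta_kernel p b)"
    using assms by (intro integral_le beta_kernel_int) (auto intro!: beta_kernel_mono)
  then show "integral {a..b} (beta_kernel p) \<le> (b - a) * beta_kernel p b"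
    using assms by simp
qed

lemma integral_beta_kernel_split:
  assumes "0 \<le> a" "a \<le> b" "b \<le> 1"
  shows "integral {0..b} (beta_kernel p) = integral {0..a} (beta_kernel p) + integral {a..b} (beta_kernel p)"
  using assms by (intro Henstock_Kurzweil_Integration.integral_combine[symmetric] beta_kernel_int) auto

lemma integral_beta_kernel_pos:
  assumes "0 \<le> a" "a < b" "b \<le> 1"
  shows "integral {a..b} (beta_kernel p) > 0"
proof (rule ccontr)
  assume "\<not> ?thesis"
  moreover have "integral {a..b} (beta_kernel p) \<ge> 0"
    by (intro Henstock_Kurzweil_Integration.integral_nonneg beta_kernel_int beta_kernel_nonneg) (use assms in auto)
  ultimately have "integral {a..b} (beta_kernel p) = 0" by simp
  then have "\<forall>x\<in>{a..b}. beta_kernel p x = 0"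
    using assms by (subst (asm) integral_eq_0_iff)
      (auto intro: continuous_on_subset[OF beta_kernel_cont] beta_kernel_nonneg)
  then have "beta_kernel p ((a + b) / 2) = 0" using assms by simp
  then show False using assms by (simp add: beta_kernel_def)
qed

lemma Beta_eq_integral: "Beta p p = integral {0..1} (beta_kernel p)"
  using has_integral_Beta_real[of p p] p unfolding beta_kernel_def by (simp add: integral_unique)

lemma Beta_half: "Beta p p = 2 * integral {0..1/2} (beta_kernel p)"
proof -
  \<comment> \<open>The reflection of \<open>x\<close> to \<open>- x\<close> followed by a shift by
    1 realises the symmetry of the kernel under the map from \<open>u\<close> to
    \<open>1 - u\<close>.\<close>
  have "integral {1/2..1} (beta_kernel p) = integral {-1..-(1/2)} (\<lambda>x. beta_kernel p (- x))"
    using Henstock_Kurzweil_Integration.integral_reflect_real[of 1 "1/2" "beta_kernel p"] by (rule sym)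
  also have "\<dots> = integral {0 - 1..1/2 - 1} (\<lambda>x. beta_kernel p (x + 1))"
    using beta_kernel_symmetric[of "- x" for x] by (simp add: add.commute)
  also have "\<dots> = integral {0..1/2} (beta_kernel p)"
    by (rule integral_shift_real_ivl)
  finally show ?thesis
    unfolding Beta_eq_integral by (subst integral_beta_kernel_split[of "1/2" 1]) auto
qed

text \<open>The kernel has its maximum \<open>(1/4) powr (p - 1)\<close> at 1/2, and on the window
  from \<open>1/2 - h\<close> to 1/2 it is at least
  \<open>(1/4 - h\<^sup>2) powr (p - 1)\<close>.\<close>

lemma Beta_bounds:
  assumes "0 < h" "h < 1/2"
  shows "Beta p p \<le> (1/4) powr (p - 1)"
    and "h * (1/4 - h\<^sup>2) powr (p - 1) \<le> Beta p p"
proof -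
  show "Beta p p \<le> (1/4) powr (p - 1)"
    using integral_beta_kernel_bounds(2)[of 0 "1/2"] by (simp add: Beta_half beta_kernel_eq)
  have "h * (1/4 - h\<^sup>2) powr (p - 1) = (1/2 - (1/2 - h)) * beta_kernel p (1/2 - h)"
    using assms by (simp add: beta_kernel_eq algebra_simps power2_eq_square)
  also have "\<dots> \<le> integral {1/2 - h..1/2} (beta_kernel p)"
    using assms by (intro integral_beta_kernel_bounds) auto
  also have "\<dots> \<le> integral {0..1/2 - h} (beta_kernel p) + integral {1/2 - h..1/2} (beta_kernel p)"
    using integral_beta_kernel_pos[of 0 "1/2 - h"] assms by simp
  also have "\<dots> = Beta p p / 2"
    using integral_beta_kernel_split[of "1/2 - h" "1/2"] assms by (simp add: Beta_half)
  also have "\<dots> \<le> Beta p p"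
    using integral_beta_kernel_pos[of 0 1] by (simp add: Beta_eq_integral)
  finally show "h * (1/4 - h\<^sup>2) powr (p - 1) \<le> Beta p p" .
qed

lemma reg_inc_Beta_eq: "reg_inc_Beta t p p = integral {0..t} (beta_kernel p) / Beta p p"
  by (simp add: reg_inc_Beta_def beta_kernel_def[abs_def])

lemma reg_inc_Beta_strict_mono:
  assumes "0 \<le> t" "t < u" "u \<le> 1"
  shows "reg_inc_Beta t p p < reg_inc_Beta u p p"
proof -
  have "Beta p p > 0" using integral_beta_kernel_pos[of 0 1] by (simp add: Beta_eq_integral)
  then show ?thesis
    using integral_beta_kernel_split[of t u] integral_beta_kernel_pos[of t u] assms
    by (simp add: reg_inc_Beta_eq divide_strict_right_mono)
qed

text \<open>Resolves the definite description in \<open>kappa\<close>: the intermediate value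
  theorem on the left half, where the values run from 0 to 1/2, gives existence, and strict
  monotonicity on the unit interval gives uniqueness.\<close>

lemma reg_inc_Beta_quantile:
  assumes "0 \<le> q" "q \<le> 1/2"
  defines "\<kappa> \<equiv> THE t. t \<in> {0..1} \<and> reg_inc_Beta t p p = q"
  shows "0 \<le> \<kappa>" "\<kappa> \<le> 1/2" "reg_inc_Beta \<kappa> p p = q"
proof -
  have B: "Beta p p > 0" using integral_beta_kernel_pos[of 0 1] by (simp add: Beta_eq_integral)
  have "continuous_on {0..1/2} (\<lambda>t. reg_inc_Beta t p p)"
    unfolding reg_inc_Beta_eq using B
    by (intro continuous_on_divide indefinite_integral_continuous_1 beta_kernel_int continuous_on_const) auto
  moreover have "reg_inc_Beta 0 p p = 0" by (simp add: reg_inc_Beta_def)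
  moreover have "reg_inc_Beta (1/2) p p = 1/2" using B by (simp add: reg_inc_Beta_eq Beta_half)
  ultimately obtain t where t: "0 \<le> t" "t \<le> 1/2" "reg_inc_Beta t p p = q"
    using IVT'[of "\<lambda>t. reg_inc_Beta t p p" 0 q "1/2"] assms by auto
  have "\<kappa> = t"
    unfolding \<kappa>_def
  proof (rule the_equality)
    fix u assume "u \<in> {0..1} \<and> reg_inc_Beta u p p = q"
    then show "u = t"
      using reg_inc_Beta_strict_mono[of u t] reg_inc_Beta_strict_mono[of t u] t
      by (cases u t rule: linorder_cases) auto
  qed (use t in auto)
  with t show "0 \<le> \<kappa>" "\<kappa> \<le> 1/2" "reg_inc_Beta \<kappa> p p = q" by auto
qed

text \<open>The mass \<open>q * Beta p p\<close> of the interval from 0 to \<open>t\<close> is at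
  most \<open>beta_kernel p t\<close>, and at least \<open>h\<close> times the kernel at
  \<open>t - h\<close>. Inserting \<open>Beta_bounds\<close>, cancelling
  \<open>(1/4) powr (p - 1)\<close> and taking roots gives the two estimates.\<close>

lemma reg_inc_Beta_quantile_bounds:
  assumes t: "0 \<le> t" "t \<le> 1/2" "reg_inc_Beta t p p = q" and q: "0 < q" and h: "0 < h" "h < 1/2"
  shows "(1 - 4 * h\<^sup>2) * (h * q) powr (1 / (p - 1)) \<le> 4 * t * (1 - t)"
    and "4 * t * (1 - t) \<le> 4 * h + 4 * h\<^sup>2 + (q / h) powr (1 / (p - 1))"
proof -
  define e where "e = p - 1"
  have e: "e > 0" using p by (simp add: e_def)
  have B: "Beta p p > 0" using integral_beta_kernel_pos[of 0 1] by (simp add: Beta_eq_integral)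
  have I: "integral {0..t} (beta_kernel p) = q * Beta p p"
    using t B by (simp add: reg_inc_Beta_eq field_simps)
  have h2: "4 * h\<^sup>2 < 1" using h mult_strict_mono[of h "1/2" h "1/2"] by (simp add: power2_eq_square)
  have root: "(x powr e) powr (1 / e) = x" if "x \<ge> 0" for x
    using e that by (simp add: powr_powr)
  \<comment> \<open>Splits off the factor \<open>(1/4) powr e\<close>, which is common to both sides
    of each estimate and cancels.\<close>
  have quarter: "(x / 4) powr e = x powr e * (1/4) powr e" if "x \<ge> 0" for x
    using that powr_mult[of x "1/4" e] by simp
  have "q * (h * (1/4 - h\<^sup>2) powr e) \<le> q * Beta p p"
    using Beta_bounds(2)[OF h] q by (intro mult_left_mono) (auto simp: e_def)
  also have "\<dots> \<le> t * beta_kernel p t"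
    using integral_beta_kernel_bounds(2)[of 0 t] t I by simp
  also have "\<dots> \<le> 1 * (t * (1 - t)) powr e"
    using t by (intro mult_mono) (auto simp: beta_kernel_eq e_def)
  finally have "q * (h * ((1 - 4 * h\<^sup>2) / 4) powr e) \<le> ((4 * t * (1 - t)) / 4) powr e"
    by (simp add: diff_divide_distrib)
  then have "(q * h * (1 - 4 * h\<^sup>2) powr e) * (1/4) powr e \<le> (4 * t * (1 - t)) powr e * (1/4) powr e"
    using h2 t by (subst (asm) (1 2) quarter) (auto simp: mult_ac)
  then have "h * q * (1 - 4 * h\<^sup>2) powr e \<le> (4 * t * (1 - t)) powr e"
    by (simp add: mult_ac)
  then have "(h * q * (1 - 4 * h\<^sup>2) powr e) powr (1 / e) \<le> ((4 * t * (1 - t)) powr e) powr (1 / e)"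
    using e h q by (intro powr_mono2) auto
  then show "(1 - 4 * h\<^sup>2) * (h * q) powr (1 / (p - 1)) \<le> 4 * t * (1 - t)"
    using h q h2 t root by (simp add: powr_mult e_def mult.commute)
  show "4 * t * (1 - t) \<le> 4 * h + 4 * h\<^sup>2 + (q / h) powr (1 / (p - 1))"
  \<comment> \<open>If \<open>t \<le> h\<close>, the window from \<open>t - h\<close> to
    \<open>t\<close> may leave the unit interval, but then the summand \<open>4 * h\<close> alone
    dominates.\<close>
  proof (cases "t \<le> h")
    case True
    have "t * (1 - t) \<le> h * 1" using True t h by (intro mult_mono) auto
    moreover have "0 \<le> 4 * h\<^sup>2 + (q / h) powr (1 / (p - 1))" by simp
    ultimately show ?thesis by linarith
  next
    case False
    \<comment> \<open>The kernel bound controls \<open>4 * u * (1 - u)\<close> at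
      \<open>u = t - h\<close>; moving back to \<open>t\<close> costs at most
      \<open>4 * h + 4 * h\<^sup>2\<close>.\<close>
    define z where "z = 4 * (t - h) * (1 - (t - h))"
    have z: "z \<ge> 0" using False h t by (simp add: z_def)
    have "h * (z / 4) powr e = (t - (t - h)) * beta_kernel p (t - h)"
    proof -
      have "z / 4 = (t - h) * (1 - (t - h))" by (simp add: z_def)
      then show ?thesis using False h t by (simp add: beta_kernel_eq e_def)
    qed
    also have "\<dots> \<le> integral {t - h..t} (beta_kernel p)"
      using False h t by (intro integral_beta_kernel_bounds) auto
    also have "\<dots> \<le> integral {0..t - h} (beta_kernel p) + integral {t - h..t} (beta_kernel p)"
      using integral_beta_kernel_pos[of 0 "t - h"] False h t by simp
    also have "\<dots> = q * Beta p p"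
      using integral_beta_kernel_split[of "t - h" t] I False h t by simp
    also have "\<dots> \<le> q * (1/4) powr e"
      using Beta_bounds(1)[OF h] q by (simp add: e_def)
    finally have "(h * z powr e) * (1/4) powr e \<le> q * (1/4) powr e"
      using quarter[OF z] by (simp add: mult_ac)
    then have "h * z powr e \<le> q" by simp
    then have "z powr e \<le> q / h" using h by (simp add: field_simps)
    then have "(z powr e) powr (1 / e) \<le> (q / h) powr (1 / e)"
      using e by (intro powr_mono2) auto
    then have "z \<le> (q / h) powr (1 / e)" using root z by simp
    moreover have "4 * t * (1 - t) = z + 4 * h - 8 * (h * t) + 4 * h\<^sup>2"
      by (simp add: z_def algebra_simps power2_eq_square)
    moreover have "h * t \<ge> 0" using h t by simp
    ultimately show ?thesis unfolding e_def by linarith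
  qed
qed

end

text \<open>With \<open>y = 4 * \<kappa> * (1 - \<kappa>)\<close>, the quantile bounds give the
  limit of \<open>y\<close> by letting \<open>d\<close> tend to infinity at fixed \<open>h\<close>,
  and only then \<open>h\<close> to 0. The branch \<open>\<kappa> \<le> 1/2\<close> allows solving
  for \<open>\<kappa>\<close>.\<close>

lemma kappa_tendsto:
  fixes n :: "nat \<Rightarrow> nat"
  assumes n: "filterlim n at_top sequentially"
    and m: "(\<lambda>d. (1 / real (n d)) powr (1 / (delta d - 1))) \<longlonglongrightarrow> m"
  shows "\<forall>\<^sub>F d in sequentially. 0 \<le> kappa (n d) d \<and> kappa (n d) d \<le> 1/2"
    and "(\<lambda>d. kappa (n d) d) \<longlonglongrightarrow> (1 - sqrt (1 - m)) / 2"
proof -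
  define y where "y d = 4 * kappa (n d) d * (1 - kappa (n d) d)" for d
  define e where "e d = 1 / (delta d - 1)" for d
  have "\<forall>\<^sub>F d in sequentially. n d \<ge> 2" using n by (simp add: filterlim_at_top)
  \<comment> \<open>At \<open>d = 3\<close> the parameter \<open>delta d\<close> is exactly 1, so
    the condition \<open>p > 1\<close> holds only from \<open>d = 4\<close> on;
    \<open>n d \<ge> 2\<close> puts the quantile level at or below 1/2.\<close>
  then have ev: "\<forall>\<^sub>F d in sequentially. n d \<ge> 2 \<and> d \<ge> 4"
    using eventually_ge_at_top[of 4] by eventually_elim auto
  have quant: "0 \<le> kappa (n d) d \<and> kappa (n d) d \<le> 1/2
      \<and> reg_inc_Beta (kappa (n d) d) (delta d) (delta d) = 1 / real (n d) \<and> delta d > 1"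
    if "n d \<ge> 2 \<and> d \<ge> 4" for d
    using reg_inc_Beta_quantile[of "delta d" "1 / real (n d)"] that
    by (auto simp: delta_def kappa_def divide_simps)
  show range: "\<forall>\<^sub>F d in sequentially. 0 \<le> kappa (n d) d \<and> kappa (n d) d \<le> 1/2"
    using ev by eventually_elim (use quant in blast)
  have e0: "e \<longlonglongrightarrow> 0" unfolding e_def delta_def by real_asymp
  have hroot: "(\<lambda>d. h powr e d) \<longlonglongrightarrow> 1" if "h > 0" for h :: real
    using tendsto_powr[OF tendsto_const e0, of h] that by simp
  have low: "\<forall>\<^sub>F d in sequentially. (1 - 4 * h\<^sup>2) * (h powr e d * (1 / real (n d)) powr e d) \<le> y d"
    and up: "\<forall>\<^sub>F d in sequentially. y d \<le> 4 * h + 4 * h\<^sup>2 + (1 / h) powr e d * (1 / real (n d)) powr e d"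
    if h: "0 < h" "h < 1/2" for h :: real
  proof -
    have *: "(1 - 4 * h\<^sup>2) * (h powr e d * (1 / real (n d)) powr e d) \<le> y d
        \<and> y d \<le> 4 * h + 4 * h\<^sup>2 + (1 / h) powr e d * (1 / real (n d)) powr e d"
      if "n d \<ge> 2 \<and> d \<ge> 4" for d
      using reg_inc_Beta_quantile_bounds[of "delta d" "kappa (n d) d" "1 / real (n d)" h]
        quant[OF that] that h
      by (simp add: y_def e_def mult.commute flip: powr_mult)
    show "\<forall>\<^sub>F d in sequentially. (1 - 4 * h\<^sup>2) * (h powr e d * (1 / real (n d)) powr e d) \<le> y d"
      using ev by eventually_elim (use * in blast)
    show "\<forall>\<^sub>F d in sequentially. y d \<le> 4 * h + 4 * h\<^sup>2 + (1 / h) powr e d * (1 / real (n d)) powr e d"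
      using ev by eventually_elim (use * in blast)
  qed
  have m': "(\<lambda>d. (1 / real (n d)) powr e d) \<longlonglongrightarrow> m" using m by (simp add: e_def)
  have small: "\<forall>\<^sub>F h in at_right 0. 0 < h \<and> h < (1/2 :: real)"
    by (rule eventually_at_rightI[of 0 "1/2"]) auto
  have "y \<longlonglongrightarrow> m"
  proof (rule order_tendstoI)
    fix a assume a: "a < m"
    \<comment> \<open>First \<open>h\<close> is fixed so small that the limit in \<open>d\<close> of
      the lower bound still exceeds \<open>a\<close>.\<close>
    have "((\<lambda>h. (1 - 4 * h\<^sup>2) * (1 * m)) \<longlongrightarrow> (1 - 4 * 0\<^sup>2) * (1 * m)) (at_right 0)"
      by (intro tendsto_intros)
    then have "\<forall>\<^sub>F h in at_right 0. a < (1 - 4 * h\<^sup>2) * (1 * m)"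
      using a by (intro order_tendstoD(1)) auto
    with small have "\<forall>\<^sub>F h in at_right 0. (0 < h \<and> h < 1/2) \<and> a < (1 - 4 * h\<^sup>2) * (1 * m)"
      by eventually_elim auto
    then obtain h where h: "0 < h" "h < 1/2" "a < (1 - 4 * h\<^sup>2) * (1 * m)"
      using eventually_happens'[of "at_right (0::real)"] by force
    have "(\<lambda>d. (1 - 4 * h\<^sup>2) * (h powr e d * (1 / real (n d)) powr e d)) \<longlonglongrightarrow> (1 - 4 * h\<^sup>2) * (1 * m)"
      using h by (intro tendsto_intros hroot m') auto
    from order_tendstoD(1)[OF this h(3)] low[OF h(1,2)]
    show "\<forall>\<^sub>F d in sequentially. a < y d" by eventually_elim auto
  next
    fix a assume a: "m < a"
    have "((\<lambda>h. 4 * h + 4 * h\<^sup>2 + 1 * m) \<longlongrightarrow> 4 * 0 + 4 * 0\<^sup>2 + 1 * m) (at_right 0)"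
      by (intro tendsto_intros)
    then have "\<forall>\<^sub>F h in at_right 0. 4 * h + 4 * h\<^sup>2 + 1 * m < a"
      using a by (intro order_tendstoD(2)) auto
    with small have "\<forall>\<^sub>F h in at_right 0. (0 < h \<and> h < 1/2) \<and> 4 * h + 4 * h\<^sup>2 + 1 * m < a"
      by eventually_elim auto
    then obtain h where h: "0 < h" "h < 1/2" "4 * h + 4 * h\<^sup>2 + 1 * m < a"
      using eventually_happens'[of "at_right (0::real)"] by force
    have "(\<lambda>d. 4 * h + 4 * h\<^sup>2 + (1 / h) powr e d * (1 / real (n d)) powr e d) \<longlonglongrightarrow> 4 * h + 4 * h\<^sup>2 + 1 * m"
      using h by (intro tendsto_intros hroot m') auto
    from order_tendstoD(2)[OF this h(3)] up[OF h(1,2)]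
    show "\<forall>\<^sub>F d in sequentially. y d < a" by eventually_elim auto
  qed
  then have "(\<lambda>d. (1 - sqrt (1 - y d)) / 2) \<longlonglongrightarrow> (1 - sqrt (1 - m)) / 2"
    by (intro tendsto_intros) auto
  moreover have "\<forall>\<^sub>F d in sequentially. (1 - sqrt (1 - y d)) / 2 = kappa (n d) d"
    using range
  proof eventually_elim
    case (elim d)
    have "1 - y d = (1 - 2 * kappa (n d) d)\<^sup>2"
      by (simp add: y_def power2_eq_square algebra_simps)
    then show ?case using elim by simp
  qed
  ultimately show "(\<lambda>d. kappa (n d) d) \<longlonglongrightarrow> (1 - sqrt (1 - m)) / 2"
    by (rule Lim_transform_eventually)
qed

subsection \<open>The laws of the norm and of the Weibull variable\<close>

lemma measurable_L2_set:
  assumes "\<And>i. i \<in> I \<Longrightarrow> (\<lambda>x. x i) \<in> borel_measurable M"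
  shows "(\<lambda>x. L2_set x I) \<in> borel_measurable M"
  unfolding L2_set_def using assms by measurable

lemma sets_borel_R_eq: "sets (lborel_R d) = sets (borel_R d)"
  unfolding lborel_R_def borel_R_def by (intro sets_PiM_cong) auto

lemma measurable_component_borel_R:
  "i < d \<Longrightarrow> (\<lambda>x. x i) \<in> borel_measurable (borel_R d)"
  unfolding borel_R_def by measurable

lemma measurable_norm_borel_R [measurable]:
  "(\<lambda>x. L2_set x {..<d}) \<in> borel_measurable (borel_R d)"
  by (rule measurable_L2_set) (auto intro: measurable_component_borel_R)

lemma measurable_scale_R:
  assumes [measurable]: "f \<in> borel_measurable M" "g \<in> M \<rightarrow>\<^sub>M borel_R d"
  shows "(\<lambda>x. scale_R d (f x) (g x)) \<in> M \<rightarrow>\<^sub>M borel_R d"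
proof -
  have [measurable]: "(\<lambda>x. g x i) \<in> borel_measurable M" if "i < d" for i
    using measurable_compose[OF assms(2) measurable_component_borel_R[OF that]] .
  show ?thesis
    unfolding scale_R_def borel_R_def by (rule measurable_restrict) auto
qed

text \<open>The ball lies between the cubes of half-side \<open>1 / d\<close> and 1, whose volumes
  are positive and finite. This is what the normalisation in \<open>uniform_sphere\<close>
  requires.\<close>

lemma emeasure_unit_ball_R:
  assumes "d > 0"
  defines "B \<equiv> {x \<in> space (lborel_R d). L2_set x {..<d} \<le> 1}"
  shows "emeasure (lborel_R d) B \<noteq> 0" "emeasure (lborel_R d) B \<noteq> \<infinity>"
proof -
  interpret product_sigma_finite "\<lambda>_::nat. lborel :: real measure" ..
  have cube: "emeasure (lborel_R d) (\<Pi>\<^sub>E i\<in>{..<d}. {- b..b}) = (ennreal (2 * b)) ^ d" if "b > 0" for b :: real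
    unfolding lborel_R_def using that by (subst emeasure_PiM) auto
  have B: "B \<in> sets (lborel_R d)"
    unfolding B_def using sets_borel_R_eq[of d] by measurable
  have "(\<Pi>\<^sub>E i\<in>{..<d}. {- (1 / real d)..1 / real d}) \<subseteq> B"
  proof
    fix x assume x: "x \<in> (\<Pi>\<^sub>E i\<in>{..<d}. {- (1 / real d)..1 / real d})"
    have "L2_set x {..<d} \<le> (\<Sum>i<d. \<bar>x i\<bar>)" by (rule L2_set_le_sum_abs)
    also have "\<dots> \<le> (\<Sum>i<d. 1 / real d)"
      using x by (intro sum_mono) (auto simp: PiE_iff abs_le_iff minus_le_iff)
    also have "\<dots> = 1" using assms by simp
    finally show "x \<in> B"
      using x by (auto simp: B_def lborel_R_def space_PiM PiE_iff)
  qed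
  then have "emeasure (lborel_R d) (\<Pi>\<^sub>E i\<in>{..<d}. {- (1 / real d)..1 / real d}) \<le> emeasure (lborel_R d) B"
    using B by (intro emeasure_mono) auto
  moreover have "emeasure (lborel_R d) (\<Pi>\<^sub>E i\<in>{..<d}. {- (1 / real d)..1 / real d}) > 0"
    using assms by (subst cube) (auto simp: ennreal_power zero_less_power)
  ultimately show "emeasure (lborel_R d) B \<noteq> 0" by auto
  have "B \<subseteq> (\<Pi>\<^sub>E i\<in>{..<d}. {- 1..1})"
  proof
    fix x assume x: "x \<in> B"
    have "\<bar>x i\<bar> \<le> 1" if "i < d" for i
    proof -
      have "\<bar>x i\<bar> \<le> L2_set (\<lambda>i. \<bar>x i\<bar>) {..<d}"
        using that by (intro member_le_L2_set) auto
      also have "\<dots> = L2_set x {..<d}" by (simp add: L2_set_def)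
      finally show ?thesis using x by (simp add: B_def)
    qed
    then show "x \<in> (\<Pi>\<^sub>E i\<in>{..<d}. {- 1..1})"
      using x by (auto simp: B_def lborel_R_def space_PiM PiE_iff abs_le_iff minus_le_iff)
  qed
  moreover have "(\<Pi>\<^sub>E i\<in>{..<d}. {- 1..1 :: real}) \<in> sets (lborel_R d)"
    unfolding lborel_R_def by (intro sets_PiM_I_finite) auto
  ultimately have "emeasure (lborel_R d) B \<le> ennreal (2 * 1) ^ d"
    using cube[of 1] by (metis emeasure_mono zero_less_one)
  then show "emeasure (lborel_R d) B \<noteq> \<infinity>"
    by (auto simp: ennreal_power top_unique simp flip: ennreal_numeral)
qed

lemma prob_space_uniform_sphere:
  assumes "d > 0"
  shows "prob_space (uniform_sphere d)"
  unfolding uniform_sphere_def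
proof (rule prob_space.prob_space_distr)
  show "prob_space (uniform_measure (lborel_R d) {x \<in> space (lborel_R d). L2_set x {..<d} \<le> 1})"
    using emeasure_unit_ball_R[OF assms] by (intro prob_space_uniform_measure) auto
  have "(\<lambda>x. scale_R d (1 / L2_set x {..<d}) x) \<in> borel_R d \<rightarrow>\<^sub>M borel_R d"
    by (rule measurable_scale_R) measurable
  then show "(\<lambda>x. scale_R d (1 / L2_set x {..<d}) x)
      \<in> uniform_measure (lborel_R d) {x \<in> space (lborel_R d). L2_set x {..<d} \<le> 1} \<rightarrow>\<^sub>M borel_R d"
    by (subst measurable_cong_sets[OF _ refl, of _ "borel_R d"]) (auto simp: sets_borel_R_eq)
qed

lemma spherically_symmetricD:
  assumes "spherically_symmetric d \<mu>" "d > 0"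
  shows "prob_space \<mu>" "sets \<mu> = sets (borel_R d)"
proof -
  obtain \<rho> where \<rho>: "real_distribution \<rho>"
    and \<mu>: "\<mu> = distr (\<rho> \<Otimes>\<^sub>M uniform_sphere d) (borel_R d) (\<lambda>(r, z). scale_R d r z)"
    using assms unfolding spherically_symmetric_def by blast
  interpret \<rho>: real_distribution \<rho> by fact
  interpret U: prob_space "uniform_sphere d" using prob_space_uniform_sphere assms by simp
  interpret P: pair_prob_space \<rho> "uniform_sphere d" ..
  have [measurable_cong]: "sets (uniform_sphere d) = sets (borel_R d)"
    by (simp add: uniform_sphere_def)
  have "(\<lambda>x. scale_R d (fst x) (snd x)) \<in> \<rho> \<Otimes>\<^sub>M uniform_sphere d \<rightarrow>\<^sub>M borel_R d"
    by (rule measurable_scale_R) measurable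
  then show "prob_space \<mu>"
    unfolding \<mu> by (intro P.prob_space_distr) (simp add: case_prod_beta')
  show "sets \<mu> = sets (borel_R d)" by (simp add: \<mu>)
qed

text \<open>A distribution on the line is determined by its c.d.f., so the Stieltjes measure of
  \<open>norm_cdf\<close> is the law of the norm itself and inherits the concentration
  hypothesis.\<close>

lemma norm_law:
  assumes "spherically_symmetric d \<mu>" "d > 0"
  shows "real_distribution (distr \<mu> borel (\<lambda>x. L2_set x {..<d}))"
    and "interval_measure (norm_cdf d \<mu>) = distr \<mu> borel (\<lambda>x. L2_set x {..<d})"
    and "A \<in> sets borel \<Longrightarrow> measure (interval_measure (norm_cdf d \<mu>)) A
           = measure \<mu> {x \<in> space \<mu>. L2_set x {..<d} \<in> A}"
proof -
  let ?N = "distr \<mu> borel (\<lambda>x. L2_set x {..<d})"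
  note [measurable_cong] = spherically_symmetricD(2)[OF assms]
  have meas: "(\<lambda>x. L2_set x {..<d}) \<in> borel_measurable \<mu>" by measurable
  interpret prob_space \<mu> using spherically_symmetricD[OF assms] by simp
  show *: "real_distribution ?N"
    by (intro real_distribution_distr meas)
  interpret N: real_distribution ?N by fact
  have "cdf (interval_measure (cdf ?N)) = cdf ?N"
    by (intro cdf_interval_measure N.cdf_nondecreasing N.cdf_is_right_cont N.cdf_lim_at_bot N.cdf_lim_at_top_prob)
  moreover have "real_distribution (interval_measure (cdf ?N))"
    by (intro real_distribution_interval_measure N.cdf_nondecreasing N.cdf_is_right_cont N.cdf_lim_at_bot N.cdf_lim_at_top_prob)
  ultimately show 2: "interval_measure (norm_cdf d \<mu>) = ?N"
    unfolding norm_cdf_def using * by (intro cdf_unique) auto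
  show "measure (interval_measure (norm_cdf d \<mu>)) A = measure \<mu> {x \<in> space \<mu>. L2_set x {..<d} \<in> A}"
    if "A \<in> sets borel"
    unfolding 2 using that by (subst measure_distr[OF meas]) (auto intro!: arg_cong[where f = "measure \<mu>"])
qed

section \<open>The Weibull law and its tails\<close>

lemma Bernoulli_powr:
  fixes x a :: real
  assumes "x \<ge> 0" "a \<ge> 1"
  shows "1 + a * x \<le> (1 + x) powr a"
proof -
  \<comment> \<open>Compares the function \<open>(1 + t) powr a - a * t\<close>, nondecreasing for
    \<open>t \<ge> 0\<close>, at the points 0 and \<open>x\<close>.\<close>
  have "(1 + 0) powr a - a * 0 \<le> (1 + x) powr a - a * x"
  proof (rule DERIV_nonneg_imp_nondecreasing[OF assms(1)])
    fix t :: real assume t: "0 \<le> t" "t \<le> x"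
    have "((\<lambda>t. (1 + t) powr a - a * t) has_real_derivative a * (1 + t) powr (a - 1) - a) (at t)"
      using t by (auto intro!: derivative_eq_intros simp: powr_diff)
    moreover have "a * (1 + t) powr (a - 1) - a \<ge> 0"
      using t assms ge_one_powr_ge_zero[of "1 + t" "a - 1"] by simp
    ultimately show "\<exists>y. ((\<lambda>t. (1 + t) powr a - a * t) has_real_derivative y) (at t) \<and> 0 \<le> y" by blast
  qed
  then show ?thesis by simp
qed

lemma weibull_real_distribution:
  assumes "delta d > 0"
  shows "real_distribution (interval_measure (weibull_cdf d))"
    and "cdf (interval_measure (weibull_cdf d)) = weibull_cdf d"
proof -
  have mono: "weibull_cdf d x \<le> weibull_cdf d y" if "x \<le> y" for x y
    using that assms by (auto simp: weibull_cdf_def intro!: powr_mono2)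
  have cont: "continuous (at_right a) (weibull_cdf d)" for a
  proof (cases "a \<ge> 0")
    case True
    \<comment> \<open>The delicate point is \<open>a = 0\<close>, where continuity of the power from
      the right relies on \<open>delta d > 0\<close>.\<close>
    have "((\<lambda>t. 1 - exp (- (t powr delta d))) \<longlongrightarrow> 1 - exp (- (a powr delta d))) (at_right a)"
      using assms True
      by (intro tendsto_intros tendsto_powr') (auto intro!: eventually_at_rightI[of 0 1])
    then show ?thesis
      unfolding continuous_within using True
      by (subst tendsto_cong[where g = "\<lambda>t. 1 - exp (- (t powr delta d))"])
         (auto simp: weibull_cdf_def intro!: eventually_at_rightI[of a "a+1"])
  next
    case False
    then have "(weibull_cdf d \<longlongrightarrow> 0) (at_right a)"
      by (intro tendsto_eventually eventually_at_rightI[of a 0]) (auto simp: weibull_cdf_def)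
    then show ?thesis
      using False by (simp add: continuous_within weibull_cdf_def)
  qed
  have bot: "(weibull_cdf d \<longlongrightarrow> 0) at_bot"
    by (intro tendsto_eventually eventually_mono[OF eventually_gt_at_bot[of "0::real"]])
       (auto simp: weibull_cdf_def)
  have "((\<lambda>t. 1 - exp (- (t powr delta d))) \<longlongrightarrow> 1) at_top"
    using assms by real_asymp
  then have top: "(weibull_cdf d \<longlongrightarrow> 1) at_top"
    by (rule Lim_transform_eventually)
       (auto simp: weibull_cdf_def intro!: eventually_mono[OF eventually_ge_at_top[of "0::real"]])
  show "real_distribution (interval_measure (weibull_cdf d))"
    using mono cont bot top by (intro real_distribution_interval_measure) auto
  show "cdf (interval_measure (weibull_cdf d)) = weibull_cdf d"
    using mono cont bot top by (intro cdf_interval_measure) auto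
qed

text \<open>Below 1, \<open>1 - exp (- y) \<le> y\<close> and
  \<open>1 - \<epsilon> \<le> exp (- \<epsilon>)\<close> give exponential decay; above 1,
  Bernoulli's inequality bounds the exponent from below.\<close>

lemma weibull_tail:
  assumes "d \<ge> 3" "\<epsilon> > 0"
  shows "measure (interval_measure (weibull_cdf d)) {x. \<epsilon> \<le> \<bar>x - 1\<bar>}
    \<le> 2 * exp (- (real d / 6) * \<epsilon>)"
proof -
  let ?M = "interval_measure (weibull_cdf d)"
  \<comment> \<open>For \<open>d \<ge> 3\<close> one has \<open>delta d \<ge> d / 3\<close>; the
    further halving, which makes the rate \<open>d / 6\<close>, pays for the use of
    \<open>\<epsilon> / 2\<close> in the upper tail.\<close>
  have \<delta>: "delta d \<ge> 1" "real d / 6 * \<epsilon> \<le> delta d * (\<epsilon> / 2)"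
    using assms by (auto simp: delta_def field_simps)
  interpret real_distribution ?M
    using weibull_real_distribution \<delta> by simp
  have cdf: "measure ?M {..x} = weibull_cdf d x" for x
    using weibull_real_distribution(2)[of d] \<delta> unfolding cdf_def by (metis less_le_trans zero_less_one)
  have low: "weibull_cdf d (1 - \<epsilon>) \<le> exp (- (real d / 6) * \<epsilon>)"
  proof (cases "\<epsilon> < 1")
    case True
    have "1 - exp (- ((1 - \<epsilon>) powr delta d)) \<le> (1 - \<epsilon>) powr delta d"
      using exp_ge_add_one_self[of "- ((1 - \<epsilon>) powr delta d)"] by simp
    also have "\<dots> \<le> exp (- \<epsilon>) powr delta d"
      using True \<delta> exp_ge_add_one_self[of "- \<epsilon>"] by (intro powr_mono2) auto
    also have "\<dots> = exp (- (delta d * \<epsilon>))"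
      by (simp add: powr_def)
    also have "\<dots> \<le> exp (- (real d / 6) * \<epsilon>)"
      using \<delta> assms by (auto simp: field_simps)
    finally show ?thesis using True by (simp add: weibull_cdf_def)
  next
    case False
    then show ?thesis using \<delta> by (auto simp: weibull_cdf_def)
  qed
  have up: "1 - weibull_cdf d (1 + \<epsilon> / 2) \<le> exp (- (real d / 6) * \<epsilon>)"
  proof -
    have "1 + delta d * (\<epsilon> / 2) \<le> (1 + \<epsilon> / 2) powr delta d"
      using assms \<delta> by (intro Bernoulli_powr) auto
    then have "real d / 6 * \<epsilon> \<le> (1 + \<epsilon> / 2) powr delta d"
      using \<delta>(2) by linarith
    then show ?thesis using assms by (simp add: weibull_cdf_def)
  qed
  \<comment> \<open>The c.d.f. measures closed rays, so the closed upper tail is enclosed in the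
    open ray beyond \<open>1 + \<epsilon> / 2\<close>; this avoids left limits at
    \<open>1 + \<epsilon>\<close>.\<close>
  have "measure ?M {x. \<epsilon> \<le> \<bar>x - 1\<bar>} \<le> measure ?M ({..1 - \<epsilon>} \<union> (space ?M - {..1 + \<epsilon> / 2}))"
    using assms by (intro finite_measure_mono) auto
  also have "\<dots> \<le> measure ?M {..1 - \<epsilon>} + measure ?M (space ?M - {..1 + \<epsilon> / 2})"
    by (intro measure_Un_le) auto
  also have "measure ?M (space ?M - {..1 + \<epsilon> / 2}) = 1 - measure ?M {..1 + \<epsilon> / 2}"
    by (intro prob_compl) auto
  finally show ?thesis using low up by (simp add: cdf)
qed

section \<open>Concentration at 1 and vanishing tail moments\<close>

definition concentrated :: "(nat \<Rightarrow> real measure) \<Rightarrow> bool" where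
  "concentrated M \<longleftrightarrow> (\<exists>C>0. \<forall>d\<ge>3. real_distribution (M d) \<and>
     (\<forall>\<epsilon>>0. measure (M d) {x. \<epsilon> \<le> \<bar>x - 1\<bar>} \<le> 2 * exp (- C * real d * min \<epsilon> (\<epsilon>\<^sup>2))))"

text \<open>The Weibull tail has the linear rate \<open>\<epsilon>\<close>, the norm the Gaussian
  rate \<open>\<epsilon>\<^sup>2\<close>. The minimum in \<open>concentrated\<close> is a common
  weakening that covers both.\<close>

lemma concentrated_weibull: "concentrated (\<lambda>d. interval_measure (weibull_cdf d))"
  unfolding concentrated_def
proof (intro exI[of _ "1/6::real"] conjI allI impI)
  fix d :: nat and \<epsilon> :: real assume *: "d \<ge> 3" "\<epsilon> > 0"
  show "measure (interval_measure (weibull_cdf d)) {x. \<epsilon> \<le> \<bar>x - 1\<bar>}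
      \<le> 2 * exp (- (1/6) * real d * min \<epsilon> (\<epsilon>\<^sup>2))"
  proof (rule order_trans[OF weibull_tail[OF *]])
    have "real d / 6 * min \<epsilon> (\<epsilon>\<^sup>2) \<le> real d / 6 * \<epsilon>"
      by (intro mult_left_mono) auto
    then show "2 * exp (- (real d / 6) * \<epsilon>) \<le> 2 * exp (- (1/6) * real d * min \<epsilon> (\<epsilon>\<^sup>2))"
      by simp
  qed
qed (auto intro!: weibull_real_distribution simp: delta_def)

lemma summable_powr_times_exp:
  fixes p \<eta> :: real
  assumes "p > 0" "\<eta> > 0"
  shows "summable (\<lambda>k::nat. (2 + real (k + 2) * \<eta>) powr p * exp (- real (Suc k)))"
proof (rule summable_comparison_test_bigo)
  have "summable (\<lambda>k. exp (- 1 / 2 :: real) ^ k)" by (rule summable_geometric) simp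
  then show "summable (\<lambda>k. norm (exp (- real k / 2)))"
    by (simp flip: exp_of_nat_mult)
  show "(\<lambda>k::nat. (2 + real (k + 2) * \<eta>) powr p * exp (- real (Suc k))) \<in> O(\<lambda>k. exp (- real k / 2))"
    using assms by real_asymp
qed

text \<open>The weight \<open>1 + \<bar>x\<bar>\<close> matches the factorised majorant in
  \<open>sq_dist_powr_le\<close>, and values in \<open>ennreal\<close> avoid integrability
  conditions.\<close>

definition tail_moment :: "real measure \<Rightarrow> real \<Rightarrow> real \<Rightarrow> ennreal" where
  "tail_moment M p \<eta> = (\<integral>\<^sup>+x. ennreal ((1 + \<bar>x\<bar>) powr p) * indicator {x. \<eta> \<le> \<bar>x - 1\<bar>} x \<partial>M)"

text \<open>The tail is cut into layers of width \<open>\<eta>\<close>. On layer \<open>k\<close>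
  the weight is at most \<open>g k\<close>, while the probability is at most
  \<open>2 * exp (- \<theta> d * (k + 1))\<close>. Once \<open>\<theta> d \<ge> 1\<close>, a factor
  \<open>exp (1 - \<theta> d)\<close> splits off and leaves a convergent series \<open>S\<close>
  independent of \<open>d\<close>.\<close>

lemma tail_moment_tendsto_0:
  assumes "concentrated M" and p: "p > 0" and \<eta>: "\<eta> > 0"
  shows "(\<lambda>d. tail_moment (M d) p \<eta>) \<longlonglongrightarrow> 0"
proof -
  obtain C where C: "C > 0" and rd: "\<And>d. d \<ge> 3 \<Longrightarrow> real_distribution (M d)"
    and tail: "\<And>d \<epsilon>. d \<ge> 3 \<Longrightarrow> \<epsilon> > 0 \<Longrightarrow>
      measure (M d) {x. \<epsilon> \<le> \<bar>x - 1\<bar>} \<le> 2 * exp (- C * real d * min \<epsilon> (\<epsilon>\<^sup>2))"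
    using assms(1) unfolding concentrated_def by blast
  define g where "g k = (2 + real (k + 2) * \<eta>) powr p" for k :: nat
  define S where "S = (\<Sum>k. g k * exp (- real (Suc k)))"
  define \<theta> where "\<theta> d = C * real d * min \<eta> (\<eta>\<^sup>2)" for d :: nat
  have sg: "summable (\<lambda>k. g k * exp (- real (Suc k)))"
    unfolding g_def using p \<eta> by (rule summable_powr_times_exp)
  have g0: "g k \<ge> 0" for k by (simp add: g_def)
  have pt: "ennreal ((1 + \<bar>x\<bar>) powr p) * indicator {x. \<eta> \<le> \<bar>x - 1\<bar>} x
      \<le> (\<Sum>k. ennreal (g k) * indicator {x. real (Suc k) * \<eta> \<le> \<bar>x - 1\<bar>} x)" for x :: real
  proof (cases "\<eta> \<le> \<bar>x - 1\<bar>")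
    case True
    \<comment> \<open>Layers are counted from 0, and layer 0 starts at distance
      \<open>\<eta>\<close>, hence the shift by one; the natural subtraction is exact because the
      floor is at least 1.\<close>
    define K where "K = nat \<lfloor>\<bar>x - 1\<bar> / \<eta>\<rfloor> - 1"
    have 1: "\<lfloor>\<bar>x - 1\<bar> / \<eta>\<rfloor> \<ge> 1" using True \<eta> by (simp add: le_floor_iff field_simps)
    then have "real (Suc K) = of_int \<lfloor>\<bar>x - 1\<bar> / \<eta>\<rfloor>" unfolding K_def by linarith
    then have "real (Suc K) \<le> \<bar>x - 1\<bar> / \<eta>" "\<bar>x - 1\<bar> / \<eta> < real (Suc K) + 1" by linarith+
    then have K: "real (Suc K) * \<eta> \<le> \<bar>x - 1\<bar>" "\<bar>x - 1\<bar> < real (K + 2) * \<eta>"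
      using \<eta> by (auto simp: field_simps)
    have "(1 + \<bar>x\<bar>) powr p \<le> g K"
      unfolding g_def using K p by (intro powr_mono2) auto
    then have "ennreal ((1 + \<bar>x\<bar>) powr p) * indicator {x. \<eta> \<le> \<bar>x - 1\<bar>} x
        \<le> ennreal (g K) * indicator {x. real (Suc K) * \<eta> \<le> \<bar>x - 1\<bar>} x"
      using K True by (simp add: ennreal_leI)
    also have "\<dots> = (\<Sum>k\<in>{K}. ennreal (g k) * indicator {x. real (Suc k) * \<eta> \<le> \<bar>x - 1\<bar>} x)"
      by (simp del: sum_mult_indicator)
    also have "\<dots> \<le> (\<Sum>k. ennreal (g k) * indicator {x. real (Suc k) * \<eta> \<le> \<bar>x - 1\<bar>} x)"
      by (rule sum_le_suminf) auto
    finally show ?thesis .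
  qed simp
  have bound: "(\<integral>\<^sup>+x. ennreal ((1 + \<bar>x\<bar>) powr p) * indicator {x. \<eta> \<le> \<bar>x - 1\<bar>} x \<partial>M d)
      \<le> ennreal (2 * exp (1 - \<theta> d) * S)" if d: "d \<ge> 3" "\<theta> d \<ge> 1" for d
  proof -
    interpret real_distribution "M d" using rd d by simp
    have e: "emeasure (M d) {x. real (Suc k) * \<eta> \<le> \<bar>x - 1\<bar>}
        \<le> ennreal (2 * exp (1 - \<theta> d) * exp (- real (Suc k)))" for k
    proof -
      have "real (Suc k) * min \<eta> (\<eta>\<^sup>2) \<le> min (real (Suc k) * \<eta>) ((real (Suc k) * \<eta>)\<^sup>2)"
      proof -
        have "real (Suc k) * \<eta>\<^sup>2 \<le> (real (Suc k))\<^sup>2 * \<eta>\<^sup>2"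
          by (intro mult_right_mono self_le_power) auto
        then have "real (Suc k) * min \<eta> (\<eta>\<^sup>2) \<le> (real (Suc k) * \<eta>)\<^sup>2"
          unfolding power_mult_distrib
          by (rule order_trans[rotated]) (intro mult_left_mono; simp)
        moreover have "real (Suc k) * min \<eta> (\<eta>\<^sup>2) \<le> real (Suc k) * \<eta>"
          by (intro mult_left_mono; simp)
        ultimately show ?thesis by (intro min.boundedI)
      qed
      then have "C * real d * (real (Suc k) * min \<eta> (\<eta>\<^sup>2))
          \<le> C * real d * min (real (Suc k) * \<eta>) ((real (Suc k) * \<eta>)\<^sup>2)"
        using C by (intro mult_left_mono) auto
      \<comment> \<open>The difference of the two sides is \<open>(\<theta> d - 1) * k\<close>. This
        separates the dependence on \<open>d\<close> from that on \<open>k\<close>.\<close>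
      moreover have "\<theta> d * real (Suc k) \<ge> \<theta> d - 1 + real (Suc k)"
        using mult_nonneg_nonneg[of "\<theta> d - 1" "real k"] d by (simp add: algebra_simps)
      ultimately have "- C * real d * min (real (Suc k) * \<eta>) ((real (Suc k) * \<eta>)\<^sup>2)
          \<le> 1 - \<theta> d + - real (Suc k)"
        by (simp add: \<theta>_def mult_ac)
      then have "exp (- C * real d * min (real (Suc k) * \<eta>) ((real (Suc k) * \<eta>)\<^sup>2))
          \<le> exp (1 - \<theta> d) * exp (- real (Suc k))"
        by (simp only: exp_add[symmetric] exp_le_cancel_iff)
      moreover have "measure (M d) {x. real (Suc k) * \<eta> \<le> \<bar>x - 1\<bar>}
          \<le> 2 * exp (- C * real d * min (real (Suc k) * \<eta>) ((real (Suc k) * \<eta>)\<^sup>2))"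
        by (rule tail) (use d \<eta> in auto)
      ultimately have "measure (M d) {x. real (Suc k) * \<eta> \<le> \<bar>x - 1\<bar>}
          \<le> 2 * exp (1 - \<theta> d) * exp (- real (Suc k))"
        by linarith
      then show ?thesis by (simp add: emeasure_eq_measure ennreal_leI)
    qed
    have "(\<integral>\<^sup>+x. ennreal ((1 + \<bar>x\<bar>) powr p) * indicator {x. \<eta> \<le> \<bar>x - 1\<bar>} x \<partial>M d)
        \<le> (\<integral>\<^sup>+x. (\<Sum>k. ennreal (g k) * indicator {x. real (Suc k) * \<eta> \<le> \<bar>x - 1\<bar>} x) \<partial>M d)"
      by (intro nn_integral_mono pt)
    also have "\<dots> = (\<Sum>k. \<integral>\<^sup>+x. ennreal (g k) * indicator {x. real (Suc k) * \<eta> \<le> \<bar>x - 1\<bar>} x \<partial>M d)"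
      by (intro nn_integral_suminf) measurable
    also have "\<dots> = (\<Sum>k. ennreal (g k) * emeasure (M d) {x. real (Suc k) * \<eta> \<le> \<bar>x - 1\<bar>})"
      by (intro suminf_cong nn_integral_cmult_indicator) auto
    also have "\<dots> \<le> (\<Sum>k. ennreal (2 * exp (1 - \<theta> d) * (g k * exp (- real (Suc k)))))"
    proof (intro suminf_le summableI)
      fix k
      have "ennreal (g k) * emeasure (M d) {x. real (Suc k) * \<eta> \<le> \<bar>x - 1\<bar>}
          \<le> ennreal (g k) * ennreal (2 * exp (1 - \<theta> d) * exp (- real (Suc k)))"
        by (intro mult_left_mono e) auto
      also have "\<dots> = ennreal (2 * exp (1 - \<theta> d) * (g k * exp (- real (Suc k))))"
        using g0 by (simp add: ennreal_mult[symmetric] mult_ac)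
      finally show "ennreal (g k) * emeasure (M d) {x. real (Suc k) * \<eta> \<le> \<bar>x - 1\<bar>}
          \<le> ennreal (2 * exp (1 - \<theta> d) * (g k * exp (- real (Suc k))))" .
    qed
    also have "\<dots> = ennreal (\<Sum>k. 2 * exp (1 - \<theta> d) * (g k * exp (- real (Suc k))))"
      using sg g0 by (intro suminf_ennreal2 summable_mult) auto
    also have "(\<Sum>k. 2 * exp (1 - \<theta> d) * (g k * exp (- real (Suc k)))) = 2 * exp (1 - \<theta> d) * S"
      unfolding S_def by (rule suminf_mult[OF sg])
    finally show ?thesis .
  qed
  have m0: "min \<eta> (\<eta>\<^sup>2) > 0" using \<eta> by simp
  have \<theta>_top: "filterlim \<theta> at_top sequentially"
    unfolding \<theta>_def using C m0 by real_asymp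
  have "((\<lambda>d. exp (1 - \<theta> d)) \<longlongrightarrow> 0) sequentially"
  proof -
    have "((\<lambda>t::real. exp (1 - t)) \<longlongrightarrow> 0) at_top" by real_asymp
    from filterlim_compose[OF this \<theta>_top] show ?thesis .
  qed
  then have "(\<lambda>d. ennreal (2 * exp (1 - \<theta> d) * S)) \<longlonglongrightarrow> ennreal (2 * 0 * S)"
    by (intro tendsto_intros)
  then have lim: "(\<lambda>d. ennreal (2 * exp (1 - \<theta> d) * S)) \<longlonglongrightarrow> 0" by simp
  have "\<forall>\<^sub>F d in sequentially. d \<ge> 3 \<and> \<theta> d \<ge> 1"
    using \<theta>_top by (intro eventually_conj eventually_ge_at_top) (simp add: filterlim_at_top)
  then have "\<forall>\<^sub>F d in sequentially.
      (\<integral>\<^sup>+x. ennreal ((1 + \<bar>x\<bar>) powr p) * indicator {x. \<eta> \<le> \<bar>x - 1\<bar>} x \<partial>M d)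
      \<le> ennreal (2 * exp (1 - \<theta> d) * S)"
    by (rule eventually_mono) (rule bound, auto)
  then show ?thesis
    unfolding tail_moment_def
    by (rule tendsto_sandwich[OF _ _ tendsto_const lim, rotated]) simp
qed

subsection \<open>The double integral\<close>

definition sq_dist :: "real \<Rightarrow> real \<Rightarrow> real \<Rightarrow> real \<Rightarrow> real" where
  "sq_dist k a r \<zeta> = (r - a)\<^sup>2 + 4 * a * r * k * \<zeta>"

text \<open>Counterpart of \<open>Ehat_pow\<close> as a nonnegative integral, for arbitrary laws:
  monotonicity and additivity then hold without integrability conditions.\<close>

definition EV_integral :: "real measure \<Rightarrow> real measure \<Rightarrow> real \<Rightarrow> real \<Rightarrow> real \<Rightarrow> ennreal" where
  "EV_integral N W s k a = (\<integral>\<^sup>+r. \<integral>\<^sup>+\<zeta>. ennreal (sq_dist k a r \<zeta> powr (s / 2)) * indicator {0..} \<zeta> * indicator {0..} r \<partial>W \<partial>N)"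

definition moment1p :: "real measure \<Rightarrow> real \<Rightarrow> ennreal" where
  "moment1p M p = (\<integral>\<^sup>+x. ennreal ((1 + \<bar>x\<bar>) powr p) \<partial>M)"

text \<open>Within distance \<open>\<eta>\<close> of 1 the weight is below
  \<open>(2 + \<eta>) powr p\<close>; the remainder is the tail moment. Small tail moments thus keep
  full moments bounded.\<close>

lemma moment1p_le:
  assumes "real_distribution M" "p > 0" "\<eta> > 0"
  shows "moment1p M p \<le> ennreal ((2 + \<eta>) powr p) + tail_moment M p \<eta>"
proof -
  interpret real_distribution M by fact
  have [simp]: "emeasure M UNIV = 1" using emeasure_space_1 by simp
  have "moment1p M p \<le> (\<integral>\<^sup>+x. ennreal ((2 + \<eta>) powr p)
      + ennreal ((1 + \<bar>x\<bar>) powr p) * indicator {x. \<eta> \<le> \<bar>x - 1\<bar>} x \<partial>M)"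
    unfolding moment1p_def
  proof (intro nn_integral_mono)
    fix x :: real
    show "ennreal ((1 + \<bar>x\<bar>) powr p) \<le> ennreal ((2 + \<eta>) powr p)
      + ennreal ((1 + \<bar>x\<bar>) powr p) * indicator {x. \<eta> \<le> \<bar>x - 1\<bar>} x"
      using assms by (cases "\<eta> \<le> \<bar>x - 1\<bar>") (auto intro!: ennreal_leI powr_mono2)
  qed
  also have "\<dots> = ennreal ((2 + \<eta>) powr p) + tail_moment M p \<eta>"
    unfolding tail_moment_def by (subst nn_integral_add) auto
  finally show ?thesis .
qed

lemma sq_dist_nonneg: "\<lbrakk>k \<ge> 0; a \<ge> 0; r \<ge> 0; \<zeta> \<ge> 0\<rbrakk> \<Longrightarrow> sq_dist k a r \<zeta> \<ge> 0"
  by (simp add: sq_dist_def)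

text \<open>By \<open>k \<le> 1\<close> and \<open>4 * a * r \<le> (r + a)\<^sup>2\<close> the base
  is at most \<open>(r + a)\<^sup>2 * (1 + \<zeta>)\<close>, and
  \<open>r + a \<le> (1 + a) * (1 + r)\<close>. The majorant is a product, so its double integral
  splits into moments.\<close>

lemma sq_dist_powr_le:
  assumes "0 \<le> k" "k \<le> 1" "a \<ge> 0" "r \<ge> 0" "\<zeta> \<ge> 0" "s > 0"
  shows "sq_dist k a r \<zeta> powr (s / 2) \<le> (1 + a) powr s * (1 + \<bar>r\<bar>) powr s * (1 + \<bar>\<zeta>\<bar>) powr (s / 2)"
proof -
  have "4 * a * r * k * \<zeta> \<le> 4 * a * r * 1 * \<zeta>"
    using assms by (intro mult_right_mono mult_left_mono) auto
  also have "\<dots> \<le> (r + a)\<^sup>2 * \<zeta>"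
    using assms sum_squares_bound[of r a] by (intro mult_right_mono) (auto simp: power2_sum mult_ac)
  finally have "sq_dist k a r \<zeta> \<le> (r + a)\<^sup>2 + (r + a)\<^sup>2 * \<zeta>"
    unfolding sq_dist_def using assms
    by (intro add_mono) (auto simp: power2_sum power2_diff)
  also have "\<dots> = (r + a)\<^sup>2 * (1 + \<zeta>)" by (simp add: algebra_simps)
  also have "\<dots> \<le> ((1 + a) * (1 + r))\<^sup>2 * (1 + \<zeta>)"
    using assms by (intro mult_right_mono power_mono) (auto simp: algebra_simps)
  finally have "sq_dist k a r \<zeta> powr (s / 2) \<le> (((1 + a) * (1 + r))\<^sup>2 * (1 + \<zeta>)) powr (s / 2)"
    using assms sq_dist_nonneg by (intro powr_mono2) auto
  also have "\<dots> = (1 + a) powr s * (1 + \<bar>r\<bar>) powr s * (1 + \<bar>\<zeta>\<bar>) powr (s / 2)"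
  proof -
    have "(x\<^sup>2) powr (s / 2) = x powr s" if "x > 0" for x :: real
      using that by (simp add: powr_powr flip: powr_numeral)
    then show ?thesis using assms by (simp add: powr_mult power_mult_distrib)
  qed
  finally show ?thesis .
qed

lemma sq_dist_measurable [measurable]:
  "(\<lambda>x. sq_dist k a (fst x) (snd x)) \<in> borel_measurable (borel \<Otimes>\<^sub>M borel)"
  unfolding sq_dist_def by measurable

text \<open>On the good event \<open>\<bar>r - 1\<bar> < \<eta>\<close>, \<open>\<bar>\<zeta> - 1\<bar> < \<eta>\<close> the integrand is at most \<open>B\<close>; on
  its complement it is dominated by moments.\<close>

lemma EV_integral_le:
  assumes N: "real_distribution N" and W: "real_distribution W"
    and k: "0 \<le> k" "k \<le> 1" and a: "a \<ge> 0" and s: "s > 0" and B: "B \<ge> 0"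
    and good: "\<And>r \<zeta>. \<lbrakk>r \<ge> 0; \<zeta> \<ge> 0; \<bar>r - 1\<bar> < \<eta>; \<bar>\<zeta> - 1\<bar> < \<eta>\<rbrakk> \<Longrightarrow> sq_dist k a r \<zeta> powr (s / 2) \<le> B"
  shows "EV_integral N W s k a \<le> ennreal B + ennreal ((1 + a) powr s) *
    (tail_moment N s \<eta> * moment1p W (s / 2) + moment1p N s * tail_moment W (s / 2) \<eta>)"
proof -
  interpret N: real_distribution N by fact
  interpret W: real_distribution W by fact
  have [simp]: "emeasure N UNIV = 1" "emeasure W UNIV = 1"
    using N.emeasure_space_1 W.emeasure_space_1 by simp_all
  let ?A = "ennreal ((1 + a) powr s)"
  define u where "u r = ennreal ((1 + \<bar>r\<bar>) powr s)" for r :: real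
  define v where "v r = ennreal ((1 + \<bar>r\<bar>) powr (s / 2))" for r :: real
  define b :: "real \<Rightarrow> ennreal" where "b = indicator {x. \<eta> \<le> \<bar>x - 1\<bar>}"
  have [measurable]: "u \<in> borel_measurable borel" "v \<in> borel_measurable borel" "b \<in> borel_measurable borel"
    unfolding u_def v_def b_def by measurable
  have pt: "ennreal (sq_dist k a r \<zeta> powr (s / 2)) * indicator {0..} \<zeta> * indicator {0..} r
      \<le> ennreal B + ?A * (u r * b r * v \<zeta> + u r * (v \<zeta> * b \<zeta>))" for r \<zeta>
  proof (cases "r \<ge> 0 \<and> \<zeta> \<ge> 0")
    case True
    show ?thesis
    proof (cases "\<bar>r - 1\<bar> < \<eta> \<and> \<bar>\<zeta> - 1\<bar> < \<eta>")
      case G: True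
      then show ?thesis using True good[of r \<zeta>] by (simp add: b_def ennreal_leI)
    next
      case False
      have "ennreal (sq_dist k a r \<zeta> powr (s / 2)) \<le> ?A * (u r * v \<zeta>)"
        using sq_dist_powr_le[of k a r \<zeta> s] True k a s
        by (simp add: u_def v_def ennreal_leI mult.assoc flip: ennreal_mult)
      \<comment> \<open>Off the good event at least one of \<open>b r\<close>,
        \<open>b \<zeta>\<close> is 1, so at least one summand is the full product
        \<open>u r * v \<zeta>\<close>.\<close>
      also have "\<dots> \<le> ?A * (u r * b r * v \<zeta> + u r * (v \<zeta> * b \<zeta>))"
        using False by (intro mult_left_mono) (auto simp: b_def indicator_def)
      also have "\<dots> \<le> ennreal B + \<dots>" by (simp add: add_increasing)
      finally show ?thesis using True by simp
    qed
  qed auto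
  have "EV_integral N W s k a \<le>
      (\<integral>\<^sup>+r. \<integral>\<^sup>+\<zeta>. ennreal B + ?A * (u r * b r * v \<zeta> + u r * (v \<zeta> * b \<zeta>)) \<partial>W \<partial>N)"
    unfolding EV_integral_def by (intro nn_integral_mono pt)
  also have "\<dots> = (\<integral>\<^sup>+r. ennreal B + ?A * (u r * b r * (\<integral>\<^sup>+\<zeta>. v \<zeta> \<partial>W) + u r * (\<integral>\<^sup>+\<zeta>. v \<zeta> * b \<zeta> \<partial>W)) \<partial>N)"
    by (intro nn_integral_cong)
       (simp add: nn_integral_add nn_integral_cmult)
  also have "\<dots> = ennreal B + ?A * ((\<integral>\<^sup>+r. u r * b r \<partial>N) * (\<integral>\<^sup>+\<zeta>. v \<zeta> \<partial>W)
      + (\<integral>\<^sup>+r. u r \<partial>N) * (\<integral>\<^sup>+\<zeta>. v \<zeta> * b \<zeta> \<partial>W))"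
    by (simp add: nn_integral_add nn_integral_cmult nn_integral_multc)
  finally show ?thesis
    unfolding tail_moment_def moment1p_def u_def v_def b_def .
qed

text \<open>Restricts the integral to the good event; \<open>\<eta> < 1\<close> makes
  \<open>r\<close> and \<open>\<zeta>\<close> positive there, so both indicators equal 1.\<close>

lemma EV_integral_ge:
  assumes N: "real_distribution N" and W: "real_distribution W"
    and \<eta>: "0 < \<eta>" "\<eta> < 1"
    and good: "\<And>r \<zeta>. \<lbrakk>r \<ge> 0; \<zeta> \<ge> 0; \<bar>r - 1\<bar> < \<eta>; \<bar>\<zeta> - 1\<bar> < \<eta>\<rbrakk> \<Longrightarrow> B \<le> sq_dist k a r \<zeta> powr (s / 2)"
  shows "ennreal B * emeasure W {x. \<bar>x - 1\<bar> < \<eta>} * emeasure N {x. \<bar>x - 1\<bar> < \<eta>} \<le> EV_integral N W s k a"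
proof -
  interpret N: real_distribution N by fact
  interpret W: real_distribution W by fact
  define g :: "real \<Rightarrow> ennreal" where "g = indicator {x. \<bar>x - 1\<bar> < \<eta>}"
  have [measurable]: "g \<in> borel_measurable borel" unfolding g_def by measurable
  have pt: "ennreal B * g \<zeta> * g r
      \<le> ennreal (sq_dist k a r \<zeta> powr (s / 2)) * indicator {0..} \<zeta> * indicator {0..} r" for r \<zeta>
    using good[of r \<zeta>] \<eta> by (auto simp: g_def indicator_def ennreal_leI)
  have "ennreal B * emeasure W {x. \<bar>x - 1\<bar> < \<eta>} * emeasure N {x. \<bar>x - 1\<bar> < \<eta>}
      = ennreal B * (\<integral>\<^sup>+\<zeta>. g \<zeta> \<partial>W) * (\<integral>\<^sup>+r. g r \<partial>N)"
    by (simp add: g_def)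
  also have "\<dots> = (\<integral>\<^sup>+r. \<integral>\<^sup>+\<zeta>. ennreal B * g \<zeta> * g r \<partial>W \<partial>N)"
    by (simp add: nn_integral_cmult nn_integral_multc)
  also have "\<dots> \<le> EV_integral N W s k a"
    unfolding EV_integral_def by (intro nn_integral_mono pt)
  finally show ?thesis .
qed

text \<open>Finite moments make both the inner and the outer Bochner integrals genuine, so neither
  falls back to the default value 0.\<close>

lemma Ehat_pow_eq_EV_integral:
  fixes d :: nat and \<mu> s n
  defines "N \<equiv> interval_measure (norm_cdf d \<mu>)" and "W \<equiv> interval_measure (weibull_cdf d)"
  assumes N: "real_distribution N" and W: "real_distribution W"
    and k: "0 \<le> kappa n d" "kappa n d \<le> 1" and a: "a \<ge> 0" and s: "s > 0"
    and fin: "moment1p N s < \<infinity>" "moment1p W (s / 2) < \<infinity>"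
  shows "ennreal (Ehat_pow d \<mu> s n a) = EV_integral N W s (kappa n d) a"
proof -
  interpret N: real_distribution N by fact
  interpret W: real_distribution W by fact
  let ?k = "kappa n d"
  define f where "f r \<zeta> = sq_dist ?k a r \<zeta> powr (s / 2) * indicator {0..} \<zeta> * indicator {0..} r" for r \<zeta> :: real
  have f_meas [measurable]: "(\<lambda>x. f (fst x) (snd x)) \<in> borel_measurable (borel \<Otimes>\<^sub>M borel)"
    unfolding f_def by measurable
  have f0: "f r \<zeta> \<ge> 0" for r \<zeta> by (simp add: f_def)
  have f_le: "ennreal (f r \<zeta>) \<le> ennreal ((1 + a) powr s * (1 + \<bar>r\<bar>) powr s) * ennreal ((1 + \<bar>\<zeta>\<bar>) powr (s / 2))" for r \<zeta>
    using sq_dist_powr_le[of ?k a r \<zeta> s] k a s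
    by (auto simp: f_def indicator_def ennreal_leI simp flip: ennreal_mult)
  have inner_le: "(\<integral>\<^sup>+\<zeta>. f r \<zeta> \<partial>W) \<le> ennreal ((1 + a) powr s * (1 + \<bar>r\<bar>) powr s) * moment1p W (s / 2)" for r
    unfolding moment1p_def by (subst nn_integral_cmult[symmetric]) (auto intro!: nn_integral_mono f_le)
  have f_int: "integrable W (f r)" for r
  proof (rule integrableI_bounded)
    have "(\<lambda>\<zeta>. f (fst (r, \<zeta>)) (snd (r, \<zeta>))) \<in> borel_measurable W"
      by measurable
    then show "f r \<in> borel_measurable W" by simp
    show "(\<integral>\<^sup>+\<zeta>. ennreal (norm (f r \<zeta>)) \<partial>W) < \<infinity>"
      using order.strict_trans1[OF inner_le[of r]] fin f0 by (simp add: ennreal_mult_less_top)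
  qed
  define F where "F r = (\<integral>\<zeta>. f r \<zeta> \<partial>W)" for r
  have F: "ennreal (F r) = (\<integral>\<^sup>+\<zeta>. f r \<zeta> \<partial>W)" for r
    unfolding F_def by (rule nn_integral_eq_integral[symmetric]) (auto intro: f_int f0)
  have F0: "F r \<ge> 0" for r unfolding F_def by (simp add: f0)
  have F_meas: "F \<in> borel_measurable N"
  proof -
    have "(\<lambda>(r, \<zeta>). f r \<zeta>) \<in> borel_measurable (N \<Otimes>\<^sub>M W)"
      by (simp add: case_prod_beta')
    then show ?thesis unfolding F_def by (rule W.borel_measurable_lebesgue_integral)
  qed
  have F_int: "integrable N F"
  proof (rule integrableI_bounded[OF F_meas])
    have "(\<integral>\<^sup>+r. ennreal (norm (F r)) \<partial>N)
        \<le> (\<integral>\<^sup>+r. ennreal ((1 + a) powr s) * ennreal ((1 + \<bar>r\<bar>) powr s) * moment1p W (s / 2) \<partial>N)"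
      using inner_le F0 by (intro nn_integral_mono) (simp add: F ennreal_mult)
    also have "\<dots> = ennreal ((1 + a) powr s) * moment1p N s * moment1p W (s / 2)"
      unfolding moment1p_def by (simp add: nn_integral_cmult nn_integral_multc)
    also have "\<dots> < \<infinity>" using fin by (simp add: ennreal_mult_less_top)
    finally show "(\<integral>\<^sup>+r. ennreal (norm (F r)) \<partial>N) < \<infinity>" .
  qed
  have "Ehat_pow d \<mu> s n a = (\<integral>r. F r \<partial>N)"
    unfolding Ehat_pow_def set_lebesgue_integral_def F_def N_def W_def f_def sq_dist_def
    by (intro Bochner_Integration.integral_cong refl)
       (auto simp: mult_ac intro!: Bochner_Integration.integral_cong split: split_indicator)
  then have "ennreal (Ehat_pow d \<mu> s n a) = (\<integral>\<^sup>+r. F r \<partial>N)"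
    using nn_integral_eq_integral[OF F_int] F0 by simp
  also have "\<dots> = EV_integral N W s ?k a"
    unfolding F EV_integral_def f_def
    by (intro nn_integral_cong) (auto simp: ennreal_mult' split: split_indicator)
  finally show ?thesis .
qed

subsection \<open>Convergence of the minimisers\<close>

lemma concentrated_norm_law:
  assumes sph: "\<And>d. d \<ge> 3 \<Longrightarrow> spherically_symmetric d (\<mu> d)" and c: "c > 0"
    and conc: "\<And>d \<epsilon>. d \<ge> 3 \<Longrightarrow> \<epsilon> > 0 \<Longrightarrow>
           measure (\<mu> d) {x \<in> space (\<mu> d). \<bar>L2_set x {..<d} - 1\<bar> \<ge> \<epsilon>}
             \<le> 2 * exp (- c * real d * \<epsilon>\<^sup>2)"
  shows "concentrated (\<lambda>d. interval_measure (norm_cdf d (\<mu> d)))"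
  unfolding concentrated_def
proof (intro exI[of _ c] conjI allI impI c)
  fix d :: nat assume d: "d \<ge> 3"
  then have d0: "d > 0" by simp
  show "real_distribution (interval_measure (norm_cdf d (\<mu> d)))"
    using norm_law(1,2)[OF sph[OF d] d0] by simp
  fix \<epsilon> :: real assume \<epsilon>: "\<epsilon> > 0"
  have "measure (interval_measure (norm_cdf d (\<mu> d))) {x. \<epsilon> \<le> \<bar>x - 1\<bar>}
      \<le> 2 * exp (- c * real d * \<epsilon>\<^sup>2)"
    using conc[OF d \<epsilon>] by (subst norm_law(3)[OF sph[OF d] d0]) auto
  also have "\<dots> \<le> 2 * exp (- c * real d * min \<epsilon> (\<epsilon>\<^sup>2))"
  proof -
    have "c * real d * min \<epsilon> (\<epsilon>\<^sup>2) \<le> c * real d * \<epsilon>\<^sup>2"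
      using c by (intro mult_left_mono) auto
    then show ?thesis by simp
  qed
  finally show "measure (interval_measure (norm_cdf d (\<mu> d))) {x. \<epsilon> \<le> \<bar>x - 1\<bar>}
      \<le> 2 * exp (- c * real d * min \<epsilon> (\<epsilon>\<^sup>2))" .
qed

lemma concentrated_eventually_real_distribution:
  "concentrated M \<Longrightarrow> \<forall>\<^sub>F d in sequentially. real_distribution (M d)"
  unfolding concentrated_def by (auto intro: eventually_mono[OF eventually_ge_at_top[of 3]])

lemma eventually_moment1p_finite:
  assumes "concentrated M" "p > 0"
  shows "\<forall>\<^sub>F d in sequentially. moment1p (M d) p < \<infinity>"
proof -
  have "\<forall>\<^sub>F d in sequentially. tail_moment (M d) p 1 < 1"
    using tail_moment_tendsto_0[OF assms, of 1] by (intro order_tendstoD(2)) auto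
  with concentrated_eventually_real_distribution[OF assms(1)]
  show ?thesis
  proof eventually_elim
    case (elim d)
    have "moment1p (M d) p \<le> ennreal ((2 + 1) powr p) + tail_moment (M d) p 1"
      using elim assms by (intro moment1p_le) auto
    also have "\<dots> < \<infinity>" using elim by (auto simp: ennreal_add_less_top order.strict_trans)
    finally show ?case .
  qed
qed

lemma concentrated_near_one:
  assumes "concentrated M" "\<eta> > 0"
  shows "(\<lambda>d. emeasure (M d) {x. \<bar>x - 1\<bar> < \<eta>}) \<longlonglongrightarrow> 1"
proof -
  obtain C where C: "C > 0" and rd: "\<And>d. d \<ge> 3 \<Longrightarrow> real_distribution (M d)"
    and tail: "\<And>d \<epsilon>. d \<ge> 3 \<Longrightarrow> \<epsilon> > 0 \<Longrightarrow>
      measure (M d) {x. \<epsilon> \<le> \<bar>x - 1\<bar>} \<le> 2 * exp (- C * real d * min \<epsilon> (\<epsilon>\<^sup>2))"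
    using assms(1) unfolding concentrated_def by blast
  have m: "min \<eta> (\<eta>\<^sup>2) > 0" using assms by simp
  have *: "ennreal (1 - 2 * exp (- C * real d * min \<eta> (\<eta>\<^sup>2))) \<le> emeasure (M d) {x. \<bar>x - 1\<bar> < \<eta>}
      \<and> emeasure (M d) {x. \<bar>x - 1\<bar> < \<eta>} \<le> 1" if d: "d \<ge> 3" for d
  proof -
    interpret real_distribution "M d" using rd d by simp
    have "{x. \<bar>x - 1\<bar> < \<eta>} = space (M d) - {x. \<eta> \<le> \<bar>x - 1\<bar>}" by auto
    then have "measure (M d) {x. \<bar>x - 1\<bar> < \<eta>} = 1 - measure (M d) {x. \<eta> \<le> \<bar>x - 1\<bar>}"
      using prob_compl[of "{x. \<eta> \<le> \<bar>x - 1\<bar>}"] by simp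
    then show ?thesis
      using tail[OF d assms(2)] prob_le_1[of "{x. \<bar>x - 1\<bar> < \<eta>}"]
      by (auto simp: emeasure_eq_measure intro!: ennreal_leI)
  qed
  have "(\<lambda>d. 1 - 2 * exp (- x * real d)) \<longlonglongrightarrow> 1" if "x > 0" for x :: real
    using that by real_asymp
  from this[of "C * min \<eta> (\<eta>\<^sup>2)"]
  have "(\<lambda>d. 1 - 2 * exp (- C * real d * min \<eta> (\<eta>\<^sup>2))) \<longlonglongrightarrow> 1"
    using C m by (simp add: mult_ac)
  then have low: "(\<lambda>d. ennreal (1 - 2 * exp (- C * real d * min \<eta> (\<eta>\<^sup>2)))) \<longlonglongrightarrow> 1"
    using tendsto_ennrealI by fastforce
  have "\<forall>\<^sub>F d in sequentially.
      ennreal (1 - 2 * exp (- C * real d * min \<eta> (\<eta>\<^sup>2))) \<le> emeasure (M d) {x. \<bar>x - 1\<bar> < \<eta>}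
      \<and> emeasure (M d) {x. \<bar>x - 1\<bar> < \<eta>} \<le> 1"
    using eventually_ge_at_top[of 3] by eventually_elim (rule *)
  then show ?thesis
    unfolding eventually_conj_iff by (elim conjE) (rule tendsto_sandwich[OF _ _ low tendsto_const])
qed

lemma sq_dist_le_near_one:
  assumes "0 \<le> k'" "0 \<le> r" "0 \<le> \<zeta>" "0 \<le> a"
    and "\<bar>r - 1\<bar> < \<eta>" "\<bar>\<zeta> - 1\<bar> < \<eta>" "\<bar>k' - k\<bar> < \<eta>"
  shows "sq_dist k' a r \<zeta> \<le> (\<bar>1 - a\<bar> + \<eta>)\<^sup>2 + 4 * a * (1 + \<eta>) * (k + \<eta>) * (1 + \<eta>)"
  unfolding sq_dist_def
proof (intro add_mono mult_mono)
  show "(r - a)\<^sup>2 \<le> (\<bar>1 - a\<bar> + \<eta>)\<^sup>2"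
    using assms by (intro abs_le_square_iff[THEN iffD1]) auto
qed (use assms in auto)

text \<open>The square is completed in \<open>a\<close>, which makes the bound uniform in \<open>a\<close>.\<close>

lemma sq_dist_ge_near_one:
  assumes "0 \<le> k'" "0 \<le> r" "0 \<le> \<zeta>" "0 \<le> a" "0 < \<eta>" "\<eta> < 1" "k \<le> 1/2"
    and "\<bar>r - 1\<bar> < \<eta>" "\<bar>\<zeta> - 1\<bar> < \<eta>" "\<bar>k' - k\<bar> < \<eta>"
  defines "\<beta> \<equiv> (1 + \<eta>) * (1 - 2 * ((k - \<eta>) * (1 - \<eta>)))"
  shows "(a - \<beta>)\<^sup>2 + (1 - \<eta>)\<^sup>2 - \<beta>\<^sup>2 \<le> sq_dist k' a r \<zeta>"
proof -
  \<comment> \<open>The factor \<open>k - \<eta>\<close> may be negative, hence the case splits. The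
    bound by 1/2 keeps \<open>1 - 2 * ((k - \<eta>) * (1 - \<eta>))\<close> nonnegative, so that
    \<open>r\<close> can be replaced by \<open>1 + \<eta>\<close> below.\<close>
  have 1: "(k - \<eta>) * (1 - \<eta>) \<le> k' * \<zeta>" "(k - \<eta>) * (1 - \<eta>) \<le> 1/2"
  proof -
    show "(k - \<eta>) * (1 - \<eta>) \<le> k' * \<zeta>"
    proof (cases "k \<ge> \<eta>")
      case True
      then show ?thesis using assms by (intro mult_mono) auto
    next
      case False
      then have "(k - \<eta>) * (1 - \<eta>) \<le> 0" using assms by (intro mult_nonpos_nonneg) auto
      also have "0 \<le> k' * \<zeta>" using assms by simp
      finally show ?thesis .
    qed
    show "(k - \<eta>) * (1 - \<eta>) \<le> 1/2"
    proof (cases "k \<ge> \<eta>")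
      case True
      then have "(k - \<eta>) * (1 - \<eta>) \<le> (1/2) * 1" using assms by (intro mult_mono) auto
      then show ?thesis by simp
    next
      case False
      then have "(k - \<eta>) * (1 - \<eta>) \<le> 0" using assms by (intro mult_nonpos_nonneg) auto
      then show ?thesis by simp
    qed
  qed
  \<comment> \<open>Expanding gives \<open>sq_dist k' a r \<zeta> = r\<^sup>2 + a\<^sup>2 - 2 * a *
    (r * (1 - 2 * (k' * \<zeta>)))\<close>; it remains to bound the coefficient of the cross term by
    \<open>\<beta>\<close>.\<close>
  have "r * (1 - 2 * (k' * \<zeta>)) \<le> r * (1 - 2 * ((k - \<eta>) * (1 - \<eta>)))"
    using 1 assms by (intro mult_left_mono) auto
  also have "\<dots> \<le> \<beta>"
    unfolding \<beta>_def using 1 assms by (intro mult_right_mono) auto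
  finally have "2 * a * (r * (1 - 2 * (k' * \<zeta>))) \<le> 2 * a * \<beta>"
    using assms by (intro mult_left_mono) auto
  moreover have "(1 - \<eta>)\<^sup>2 \<le> r\<^sup>2"
    using assms by (intro power_mono) auto
  ultimately show ?thesis
    unfolding sq_dist_def by (simp add: power2_eq_square algebra_simps)
qed

lemma eventually_EV_integral_less:
  assumes N: "concentrated N" and W: "concentrated W" and s: "s > 0" and a: "a \<ge> 0"
    and k: "\<forall>\<^sub>F d in sequentially. 0 \<le> k d \<and> k d \<le> 1" and \<eta>: "\<eta> > 0" and B: "B \<ge> 0"
    and good: "\<forall>\<^sub>F d in sequentially. \<forall>r\<ge>0. \<forall>\<zeta>\<ge>0. \<bar>r - 1\<bar> < \<eta> \<longrightarrow> \<bar>\<zeta> - 1\<bar> < \<eta> \<longrightarrow>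
      sq_dist (k d) a r \<zeta> powr (s / 2) \<le> B"
    and BB: "B < B'"
  shows "\<forall>\<^sub>F d in sequentially. EV_integral (N d) (W d) s (k d) a < ennreal B'"
proof -
  define \<alpha> where "\<alpha> d = tail_moment (N d) s \<eta>" for d
  define \<beta> where "\<beta> d = tail_moment (W d) (s / 2) \<eta>" for d
  let ?A = "ennreal ((1 + a) powr s)"
  let ?p = "ennreal ((2 + \<eta>) powr s)" and ?q = "ennreal ((2 + \<eta>) powr (s / 2))"
  \<comment> \<open>\<open>R\<close> is the bound of \<open>EV_integral_le\<close> with the full
    moments replaced by \<open>moment1p_le\<close>; it depends on \<open>d\<close> through the tail
    moments only and tends to \<open>ennreal B\<close>.\<close>
  define R where "R d = ennreal B + ?A * (\<alpha> d * (?q + \<beta> d) + (?p + \<alpha> d) * \<beta> d)" for d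
  have [tendsto_intros]: "\<alpha> \<longlonglongrightarrow> 0" "\<beta> \<longlonglongrightarrow> 0"
    unfolding \<alpha>_def \<beta>_def using N W s \<eta> by (auto intro: tail_moment_tendsto_0)
  have "R \<longlonglongrightarrow> ennreal B + ?A * (0 * (?q + 0) + (?p + 0) * 0)"
    unfolding R_def by (intro tendsto_intros tendsto_mult_ennreal) auto
  then have "R \<longlonglongrightarrow> ennreal B" by simp
  then have "\<forall>\<^sub>F d in sequentially. R d < ennreal B'"
    using BB B by (intro order_tendstoD(2)) (auto simp: ennreal_less_iff)
  with concentrated_eventually_real_distribution[OF N] concentrated_eventually_real_distribution[OF W] k good
  show ?thesis
  proof eventually_elim
    case (elim d)
    have "EV_integral (N d) (W d) s (k d) a \<le> ennreal B + ?A *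
        (\<alpha> d * moment1p (W d) (s / 2) + moment1p (N d) s * \<beta> d)"
      unfolding \<alpha>_def \<beta>_def using elim a s B by (intro EV_integral_le) auto
    also have "\<dots> \<le> R d"
      unfolding R_def using elim s \<eta>
      by (intro add_left_mono mult_left_mono add_mono mult_right_mono)
         (auto simp: \<alpha>_def \<beta>_def intro!: moment1p_le)
    also have "\<dots> < ennreal B'" by fact
    finally show ?case .
  qed
qed

text \<open>At \<open>r = \<zeta> = 1\<close> the limiting base is
  \<open>(a - a0)\<^sup>2 + V\<close>. The proof separates the level near \<open>V\<close> reached
  at \<open>a0\<close> from the level at distance \<open>\<epsilon>\<close>, so comparing
  \<open>a d\<close> with the single competitor \<open>a0\<close> decides.\<close>

lemma minimiser_tendsto:
  assumes N: "concentrated N" and W: "concentrated W" and s: "s > 0"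
    and range: "\<forall>\<^sub>F d in sequentially. 0 \<le> k d \<and> k d \<le> 1" and k: "k \<longlonglongrightarrow> l" "0 \<le> l" "l \<le> 1/2"
    and min: "\<forall>\<^sub>F d in sequentially. 0 \<le> a d \<and>
      EV_integral (N d) (W d) s (k d) (a d) \<le> EV_integral (N d) (W d) s (k d) (1 - 2 * l)"
  shows "a \<longlonglongrightarrow> 1 - 2 * l"
proof (rule tendstoI)
  fix \<epsilon> :: real assume \<epsilon>: "\<epsilon> > 0"
  define a0 where "a0 = 1 - 2 * l"
  define V where "V = 1 - a0\<^sup>2"
  have a0: "0 \<le> a0" "a0 \<le> 1" using k by (auto simp: a0_def)
  have V0: "V \<ge> 0" using a0 by (simp add: V_def power_le_one)
  \<comment> \<open>\<open>u \<eta>\<close> and \<open>b \<eta>\<close> are the bound of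
    \<open>sq_dist_le_near_one\<close> at \<open>a0\<close> and the \<open>\<beta>\<close> of
    \<open>sq_dist_ge_near_one\<close>; as \<open>\<eta>\<close> tends to 0 they tend to
    \<open>V\<close> and \<open>a0\<close>.\<close>
  define u where "u \<eta> = (\<bar>1 - a0\<bar> + \<eta>)\<^sup>2 + 4 * a0 * (1 + \<eta>) * (l + \<eta>) * (1 + \<eta>)" for \<eta>
  define b where "b \<eta> = (1 + \<eta>) * (1 - 2 * ((l - \<eta>) * (1 - \<eta>)))" for \<eta>
  have "(u \<longlongrightarrow> (\<bar>1 - a0\<bar> + 0)\<^sup>2 + 4 * a0 * (1 + 0) * (l + 0) * (1 + 0)) (at_right 0)"
    unfolding u_def by (intro tendsto_intros)
  also have "(\<bar>1 - a0\<bar> + 0)\<^sup>2 + 4 * a0 * (1 + 0) * (l + 0) * (1 + 0) = V"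
    by (simp add: V_def a0_def power2_eq_square algebra_simps)
  finally have "\<forall>\<^sub>F \<eta> in at_right 0. u \<eta> < V + \<epsilon>\<^sup>2 / 16"
    using \<epsilon> by (intro order_tendstoD(2)) auto
  moreover have b: "(b \<longlongrightarrow> a0) (at_right 0)"
  proof -
    have "(b \<longlongrightarrow> (1 + 0) * (1 - 2 * ((l - 0) * (1 - 0)))) (at_right 0)"
      unfolding b_def by (intro tendsto_intros)
    then show ?thesis by (simp add: a0_def)
  qed
  then have "\<forall>\<^sub>F \<eta> in at_right 0. dist (b \<eta>) a0 < \<epsilon> / 2"
    using \<epsilon> by (intro tendstoD) auto
  \<comment> \<open>If \<open>\<bar>a - a0\<bar> \<ge> \<epsilon>\<close>, then \<open>a\<close> is
    at least \<open>\<epsilon> / 2\<close> away from \<open>b \<eta>\<close>. The limit here is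
    \<open>V + \<epsilon>\<^sup>2 / 4\<close>, which leaves room above
    \<open>V + \<epsilon>\<^sup>2 / 8\<close>.\<close>
  moreover have "((\<lambda>\<eta>. (\<epsilon> / 2)\<^sup>2 + (1 - \<eta>)\<^sup>2 - (b \<eta>)\<^sup>2) \<longlongrightarrow> (\<epsilon> / 2)\<^sup>2 + (1 - 0)\<^sup>2 - a0\<^sup>2) (at_right 0)"
    by (intro tendsto_intros b)
  then have "\<forall>\<^sub>F \<eta> in at_right 0. V + \<epsilon>\<^sup>2 / 8 < (\<epsilon> / 2)\<^sup>2 + (1 - \<eta>)\<^sup>2 - (b \<eta>)\<^sup>2"
    using \<epsilon> by (intro order_tendstoD(1)) (auto simp: V_def power_divide)
  moreover have "\<forall>\<^sub>F \<eta> in at_right (0::real). 0 < \<eta> \<and> \<eta> < 1"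
    by (rule eventually_at_rightI[of 0 1]) auto
  ultimately have "\<forall>\<^sub>F \<eta> in at_right 0. u \<eta> < V + \<epsilon>\<^sup>2 / 16 \<and> dist (b \<eta>) a0 < \<epsilon> / 2 \<and>
      V + \<epsilon>\<^sup>2 / 8 < (\<epsilon> / 2)\<^sup>2 + (1 - \<eta>)\<^sup>2 - (b \<eta>)\<^sup>2 \<and> 0 < \<eta> \<and> \<eta> < 1"
    by eventually_elim auto
  then obtain \<eta> where \<eta>: "0 < \<eta>" "\<eta> < 1" and u: "u \<eta> < V + \<epsilon>\<^sup>2 / 16"
    and b: "\<bar>b \<eta> - a0\<bar> < \<epsilon> / 2" "V + \<epsilon>\<^sup>2 / 8 < (\<epsilon> / 2)\<^sup>2 + (1 - \<eta>)\<^sup>2 - (b \<eta>)\<^sup>2"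
    using eventually_happens'[of "at_right (0::real)"] by (force simp: dist_real_def)
  define Bu where "Bu = (V + \<epsilon>\<^sup>2 / 16) powr (s / 2)"
  define Bl where "Bl = (V + \<epsilon>\<^sup>2 / 8) powr (s / 2)"
  have "Bu < Bl"
    unfolding Bu_def Bl_def using V0 \<epsilon> s by (intro powr_less_mono2) auto
  \<comment> \<open>A level strictly between leaves slack on both sides: for the error terms above
    \<open>Bu\<close>, and for the probabilities below 1 that multiply \<open>Bl\<close>.\<close>
  then obtain B where B: "Bu < B" "B < Bl" using dense by blast
  have near: "\<forall>\<^sub>F d in sequentially. \<bar>k d - l\<bar> < \<eta>"
    using tendstoD[OF k(1) \<eta>(1)] by (simp add: dist_real_def)
  have "\<forall>\<^sub>F d in sequentially. EV_integral (N d) (W d) s (k d) a0 < ennreal B"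
  proof (rule eventually_EV_integral_less[OF N W s a0(1) range \<eta>(1) _ _ B(1)])
    show "\<forall>\<^sub>F d in sequentially. \<forall>r\<ge>0. \<forall>\<zeta>\<ge>0. \<bar>r - 1\<bar> < \<eta> \<longrightarrow> \<bar>\<zeta> - 1\<bar> < \<eta> \<longrightarrow>
        sq_dist (k d) a0 r \<zeta> powr (s / 2) \<le> Bu"
      using range near
    proof eventually_elim
      case (elim d)
      show ?case
      proof (intro allI impI)
        fix r \<zeta> :: real assume *: "0 \<le> r" "0 \<le> \<zeta>" "\<bar>r - 1\<bar> < \<eta>" "\<bar>\<zeta> - 1\<bar> < \<eta>"
        have "sq_dist (k d) a0 r \<zeta> \<le> u \<eta>"
          unfolding u_def using * elim a0 by (intro sq_dist_le_near_one) auto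
        then show "sq_dist (k d) a0 r \<zeta> powr (s / 2) \<le> Bu"
          unfolding Bu_def using u s * elim a0 sq_dist_nonneg by (intro powr_mono2) auto
      qed
    qed
  qed (auto simp: Bu_def)
  moreover have "\<forall>\<^sub>F d in sequentially. ennreal B <
      ennreal Bl * emeasure (W d) {x. \<bar>x - 1\<bar> < \<eta>} * emeasure (N d) {x. \<bar>x - 1\<bar> < \<eta>}"
  proof (rule order_tendstoD(1))
    show "(\<lambda>d. ennreal Bl * emeasure (W d) {x. \<bar>x - 1\<bar> < \<eta>} * emeasure (N d) {x. \<bar>x - 1\<bar> < \<eta>})
        \<longlonglongrightarrow> ennreal Bl * 1 * 1"
      using N W \<eta> by (intro tendsto_mult_ennreal tendsto_const concentrated_near_one) auto
    have "B \<ge> 0" using B(1) by (rule order.strict_implies_order[OF order.strict_trans1[rotated]]) (simp add: Bu_def)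
    then show "ennreal B < ennreal Bl * 1 * 1" using B by (simp add: ennreal_less_iff)
  qed
  ultimately show "\<forall>\<^sub>F d in sequentially. dist (a d) (1 - 2 * l) < \<epsilon>"
    using min near range concentrated_eventually_real_distribution[OF N] concentrated_eventually_real_distribution[OF W]
  proof eventually_elim
    case (elim d)
    show ?case
    proof (rule ccontr)
      assume "\<not> ?thesis"
      then have far: "\<epsilon> \<le> \<bar>a d - a0\<bar>" by (simp add: dist_real_def a0_def)
      have "\<epsilon> / 2 \<le> \<bar>a d - b \<eta>\<bar>" using far b(1) by linarith
      then have sq: "(\<epsilon> / 2)\<^sup>2 \<le> (a d - b \<eta>)\<^sup>2"
        using \<epsilon> by (intro abs_le_square_iff[THEN iffD1]) auto
      have "ennreal Bl * emeasure (W d) {x. \<bar>x - 1\<bar> < \<eta>} * emeasure (N d) {x. \<bar>x - 1\<bar> < \<eta>}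
          \<le> EV_integral (N d) (W d) s (k d) (a d)"
      proof (rule EV_integral_ge)
        fix r \<zeta> :: real assume *: "0 \<le> r" "0 \<le> \<zeta>" "\<bar>r - 1\<bar> < \<eta>" "\<bar>\<zeta> - 1\<bar> < \<eta>"
        have "(a d - b \<eta>)\<^sup>2 + (1 - \<eta>)\<^sup>2 - (b \<eta>)\<^sup>2 \<le> sq_dist (k d) (a d) r \<zeta>"
          unfolding b_def using * elim \<eta> k by (intro sq_dist_ge_near_one) auto
        then have "V + \<epsilon>\<^sup>2 / 8 \<le> sq_dist (k d) (a d) r \<zeta>" using b(2) sq by linarith
        then show "Bl \<le> sq_dist (k d) (a d) r \<zeta> powr (s / 2)"
          unfolding Bl_def using V0 s by (intro powr_mono2) auto
      qed (use elim \<eta> in auto)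
      also have "\<dots> \<le> EV_integral (N d) (W d) s (k d) a0" using elim by (simp add: a0_def)
      also have "\<dots> < ennreal B" using elim by simp
      finally show False using elim by (auto dest: less_asym)
    qed
  qed
qed

text \<open>Treats the three regimes at once, with \<open>l\<close> the limit of
  \<open>n powr (- 1 / d)\<close>. Divergence is a separate alternative because \<open>1 / 0\<close>
  is 0.\<close>

lemma Ehat_minimiser_tendsto:
  fixes \<mu> :: "nat \<Rightarrow> (nat \<Rightarrow> real) measure"
    and c s :: real and n :: "nat \<Rightarrow> nat" and astar :: "nat \<Rightarrow> real"
  assumes sph: "\<And>d. d \<ge> 3 \<Longrightarrow> spherically_symmetric d (\<mu> d)" and c: "c > 0"
    and conc: "\<And>d \<epsilon>. d \<ge> 3 \<Longrightarrow> \<epsilon> > 0 \<Longrightarrow>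
           measure (\<mu> d) {x \<in> space (\<mu> d). \<bar>L2_set x {..<d} - 1\<bar> \<ge> \<epsilon>}
             \<le> 2 * exp (- c * real d * \<epsilon>\<^sup>2)"
    and s: "s > 0"
    and n: "filterlim n at_top sequentially"
    and argmin: "\<And>d. d \<ge> 3 \<Longrightarrow> n d \<ge> 1 \<Longrightarrow>
           is_arg_min (Ehat d (\<mu> d) s (n d)) (\<lambda>a. a \<ge> 0) (astar d)"
    and l: "(\<lambda>d. real (n d) powr (1 / real d)) \<longlonglongrightarrow> 1 / l \<or>
            l = 0 \<and> filterlim (\<lambda>d. real (n d) powr (1 / real d)) at_top sequentially"
           "0 \<le> l" "l \<le> 1"
  shows "astar \<longlonglongrightarrow> sqrt (1 - l\<^sup>2)"
proof -
  let ?N = "\<lambda>d. interval_measure (norm_cdf d (\<mu> d))"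
  let ?W = "\<lambda>d. interval_measure (weibull_cdf d)"
  define x where "x d = inverse (real (n d) powr (1 / real d))" for d
  have x: "x \<longlonglongrightarrow> l"
    using l(1)
  proof
    assume lim: "(\<lambda>d. real (n d) powr (1 / real d)) \<longlonglongrightarrow> 1 / l"
    \<comment> \<open>With \<open>l = 0\<close> this alternative would claim the limit 0, whereas
      the roots are eventually at least 1.\<close>
    have "l \<noteq> 0"
    proof
      assume "l = 0"
      have "\<forall>\<^sub>F d in sequentially. 1 \<le> real (n d) powr (1 / real d)"
      proof -
        have "\<forall>\<^sub>F d in sequentially. n d \<ge> 1" using n by (simp add: filterlim_at_top)
        then show ?thesis by eventually_elim (auto intro: ge_one_powr_ge_zero)
      qed
      with lim have "1 \<le> 1 / l" by (intro tendsto_lowerbound[OF lim]) auto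
      then show False using \<open>l = 0\<close> by simp
    qed
    then show ?thesis
      unfolding x_def using tendsto_inverse[OF lim] by simp
  next
    assume "l = 0 \<and> filterlim (\<lambda>d. real (n d) powr (1 / real d)) at_top sequentially"
    then show ?thesis unfolding x_def by (auto intro: tendsto_inverse_0_at_top)
  qed
  \<comment> \<open>The Beta bounds involve roots of order \<open>delta d - 1\<close>, about
    \<open>d / 2\<close>; this change of exponent turns \<open>l\<close> into
    \<open>l\<^sup>2\<close>.\<close>
  have "(\<lambda>d. real d / (delta d - 1)) \<longlonglongrightarrow> 2"
    unfolding delta_def by real_asymp
  then have "(\<lambda>d. x d powr (real d / (delta d - 1))) \<longlonglongrightarrow> l powr 2"
    by (intro tendsto_powr'[OF x]) (auto simp: x_def)
  moreover have "\<forall>\<^sub>F d in sequentially.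
      x d powr (real d / (delta d - 1)) = (1 / real (n d)) powr (1 / (delta d - 1))"
    using eventually_gt_at_top[of 0]
  proof eventually_elim
    case (elim d)
    then have "x d = (1 / real (n d)) powr (1 / real d)"
      by (simp add: x_def powr_divide inverse_eq_divide)
    then show ?case using elim by (simp add: powr_powr)
  qed
  ultimately have "(\<lambda>d. (1 / real (n d)) powr (1 / (delta d - 1))) \<longlonglongrightarrow> l\<^sup>2"
    using l(2) by (auto simp: powr_numeral elim: Lim_transform_eventually)
  note \<kappa> = kappa_tendsto[OF n this]
  define k where "k = (1 - sqrt (1 - l\<^sup>2)) / 2"
  have k: "0 \<le> k" "k \<le> 1/2" using l by (auto simp: k_def power_le_one)
  have N: "concentrated ?N" using sph c conc by (rule concentrated_norm_law)
  note W = concentrated_weibull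
  have range: "\<forall>\<^sub>F d in sequentially. 0 \<le> kappa (n d) d \<and> kappa (n d) d \<le> 1"
    using \<kappa>(1) by eventually_elim auto
  have n1: "\<forall>\<^sub>F d in sequentially. n d \<ge> 1" using n by (simp add: filterlim_at_top)
  have "astar \<longlonglongrightarrow> 1 - 2 * k"
  proof (rule minimiser_tendsto[OF N W s range _ k])
    show "(\<lambda>d. kappa (n d) d) \<longlonglongrightarrow> k" unfolding k_def by (rule \<kappa>(2))
    show "\<forall>\<^sub>F d in sequentially. 0 \<le> astar d \<and>
        EV_integral (?N d) (?W d) s (kappa (n d) d) (astar d)
        \<le> EV_integral (?N d) (?W d) s (kappa (n d) d) (1 - 2 * k)"
      using range n1 eventually_ge_at_top[of 3]
        concentrated_eventually_real_distribution[OF N] concentrated_eventually_real_distribution[OF W]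
        eventually_moment1p_finite[OF N s] eventually_moment1p_finite[OF W half_gt_zero[OF s]]
    proof eventually_elim
      case (elim d)
      have E: "ennreal (Ehat_pow d (\<mu> d) s (n d) a) = EV_integral (?N d) (?W d) s (kappa (n d) d) a"
        if "a \<ge> 0" for a
        using elim s that by (intro Ehat_pow_eq_EV_integral) auto
      have nonneg: "0 \<le> Ehat_pow d (\<mu> d) s (n d) a" for a
        unfolding Ehat_pow_def set_lebesgue_integral_def by (auto intro!: Bochner_Integration.integral_nonneg)
      have a: "0 \<le> astar d" "\<And>y. y \<ge> 0 \<Longrightarrow> Ehat d (\<mu> d) s (n d) (astar d) \<le> Ehat d (\<mu> d) s (n d) y"
        using argmin[of d] elim by (auto simp: is_arg_min_def not_less)
      \<comment> \<open>Minimality passes from \<open>Ehat\<close> to its \<open>s\<close>-th power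
        because \<open>powr (1 / s)\<close> is strictly increasing on nonnegative reals.\<close>
      have "Ehat_pow d (\<mu> d) s (n d) (astar d) \<le> Ehat_pow d (\<mu> d) s (n d) (1 - 2 * k)"
      proof (rule ccontr)
        assume "\<not> ?thesis"
        then have "Ehat d (\<mu> d) s (n d) (1 - 2 * k) < Ehat d (\<mu> d) s (n d) (astar d)"
          unfolding Ehat_def using s nonneg by (intro powr_less_mono2) auto
        then show False using a(2)[of "1 - 2 * k"] k by simp
      qed
      then show ?case using E[of "astar d"] E[of "1 - 2 * k"] a k by (metis diff_ge_0_iff_ge ennreal_leI le_divide_eq_numeral1(1) mult.commute)
    qed
  qed
  then show ?thesis by (simp add: k_def diff_divide_distrib)
qed

theorem proposition4p2:
  fixes \<mu> :: "nat \<Rightarrow> (nat \<Rightarrow> real) measure"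
    and c s :: real
    and n :: "nat \<Rightarrow> nat"
    and astar :: "nat \<Rightarrow> real"
  assumes "\<And>d. d \<ge> 3 \<Longrightarrow> spherically_symmetric d (\<mu> d)"
    and "c > 0"
    and "\<And>d \<epsilon>. d \<ge> 3 \<Longrightarrow> \<epsilon> > 0 \<Longrightarrow>
           measure (\<mu> d) {x \<in> space (\<mu> d). \<bar>L2_set x {..<d} - 1\<bar> \<ge> \<epsilon>}
             \<le> 2 * exp (- c * real d * \<epsilon>\<^sup>2)"
    and "s > 0"
    and "filterlim n at_top sequentially"
    and "\<And>d. d \<ge> 3 \<Longrightarrow> n d \<ge> 1 \<Longrightarrow>
           is_arg_min (Ehat d (\<mu> d) s (n d)) (\<lambda>a. a \<ge> 0) (astar d)"
  shows "(filterlim (\<lambda>d. real (n d) powr (1 / real d)) at_top sequentially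
            \<longrightarrow> astar \<longlonglongrightarrow> 1)
       \<and> (\<forall>L::real. L > 1 \<longrightarrow> (\<lambda>d. real (n d)) \<sim>[sequentially] (\<lambda>d. L ^ d)
            \<longrightarrow> astar \<longlonglongrightarrow> sqrt (1 - 1 / L\<^sup>2))
       \<and> ((\<lambda>d. ln (real (n d))) \<in> o(\<lambda>d. real d)
            \<longrightarrow> astar \<longlonglongrightarrow> 0)"
proof (intro conjI allI impI)
  note main = Ehat_minimiser_tendsto[where \<mu> = \<mu> and c = c and s = s and n = n and astar = astar, OF assms]
  show "astar \<longlonglongrightarrow> 1" if "filterlim (\<lambda>d. real (n d) powr (1 / real d)) at_top sequentially"
    using main[of 0] that by simp
  have root: "(\<lambda>d::nat. 1 / real d) \<longlonglongrightarrow> 0" by real_asymp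
  have n1: "\<forall>\<^sub>F d in sequentially. n d \<ge> 1 \<and> d > 0"
    using assms(5) by (intro eventually_conj eventually_gt_at_top) (simp add: filterlim_at_top)
  show "astar \<longlonglongrightarrow> sqrt (1 - 1 / L\<^sup>2)"
    if L: "L > 1" and eq: "(\<lambda>d. real (n d)) \<sim>[sequentially] (\<lambda>d. L ^ d)" for L :: real
  proof -
    have "(\<lambda>d. real (n d) / L ^ d) \<longlonglongrightarrow> 1"
      using eq L by (simp add: asymp_equiv_def)
    \<comment> \<open>The relative error tends to 1 and the exponent \<open>1 / d\<close> to 0, so
      the \<open>d\<close>-th root of the error tends to 1.\<close>
    then have "(\<lambda>d. (real (n d) / L ^ d) powr (1 / real d) * L) \<longlonglongrightarrow> 1 powr 0 * L"
      by (intro tendsto_intros root) auto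
    moreover have "\<forall>\<^sub>F d in sequentially.
        (real (n d) / L ^ d) powr (1 / real d) * L = real (n d) powr (1 / real d)"
      using n1 by eventually_elim (use L in \<open>auto simp: powr_divide powr_powr simp flip: powr_realpow\<close>)
    ultimately have "(\<lambda>d. real (n d) powr (1 / real d)) \<longlonglongrightarrow> 1 / (1 / L)"
      by (auto elim: Lim_transform_eventually)
    then show ?thesis using main[of "1 / L"] L by (simp add: power_divide)
  qed
  show "astar \<longlonglongrightarrow> 0" if "(\<lambda>d. ln (real (n d))) \<in> o(\<lambda>d. real d)"
  proof -
    \<comment> \<open>Subexponential growth means that \<open>n powr (1 / d)\<close> tends to 1,
      which is the case \<open>l = 1\<close>.\<close>
    have "(\<lambda>d. exp (ln (real (n d)) / real d)) \<longlonglongrightarrow> exp 0"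
      using smalloD_tendsto[OF that] by (intro tendsto_exp)
    moreover have "\<forall>\<^sub>F d in sequentially.
        exp (ln (real (n d)) / real d) = real (n d) powr (1 / real d)"
      using n1 by eventually_elim (auto simp: powr_def)
    ultimately have "(\<lambda>d. real (n d) powr (1 / real d)) \<longlonglongrightarrow> 1 / 1"
      by (auto elim: Lim_transform_eventually)
    then show ?thesis using main[of 1] by simp
  qed
qed

end
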